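(* Let $\{X_{t+1/2}\}_{t=1}^{T}$ be generated by the Extra-Newton algorithm (described in the context) with weights $a_t=t^2$ and $b_t=t^p$, where $p\ge 2$, and with the adaptive step-size $$\gamma_t=\frac{\gamma}{\sqrt{\beta_0+\sum_{s=1}^{t-1}a_s^2\,\big\|g(\bar X_{s+1/2},\xi_{s+1/2})-\tilde{\mathbf F}(\bar X_{s+1/2};\tilde X_s,\xi_s)\big\|^2}},\qquad \gamma,\beta_0>0 .$$ Assume that $f$ is second-order smooth with modulus $L$ on $\mathcal X$ and that the stochastic gradient and Hessian oracles are unbiased with variances bounded by $\sigma_g^2$ and $\sigma_H^2$ respectively (all as defined in the context). Then $$\mathbb E\big[f(\bar X_{T+1/2})-f(x^\ast)\big]\le O\left(\frac{\frac{D^2+\gamma^2}{\gamma}\,\sigma_g}{\sqrt T}+\frac{\frac{D^3+D\gamma^2}{\gamma}\,\sigma_H}{T^{3/2}}+\frac{\max\left\{L\,\frac{D^4+D\gamma^3}{\gamma},\ \sqrt{\beta_0}\,\frac{D^2+\gamma^2}{\gamma}\right\}}{T^3}\right).$$ In particular, when $\gamma=D$, the rate is $$O\left(\frac{D\sigma_g}{\sqrt T}+\frac{D^2\sigma_H}{T^{3/2}}+\frac{\max\{LD^3,\sqrt{\beta_0}\,D\}}{T^3}\right).$$ Here $O(\cdot)$ hides a multiplicative constant depending only on $p$ (not on $T,D,L,\sigma_g,\sigma_H,\gamma,\beta_0,d,f,\mathcal X$), and the bounds hold for every $T\ge1$.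
   Context: Setting. $\mathcal X\subset\mathbb R^d$ is a nonempty convex compact set with Euclidean diameter $D=\max_{x,y\in\mathcal X}\|x-y\|$; $\|\cdot\|$ is the Euclidean norm on vectors and the induced operator norm on matrices. $f:\mathbb R^d\to\mathbb R\cup\{+\infty\}$ is proper, lower semicontinuous, convex and finite on $\mathcal X$; $\nabla f(x)\in\mathbb R^d$ denotes its gradient at $x\in\mathcal X$ (so $f(y)\ge f(x)+\langle\nabla f(x),y-x\rangle$ for $x,y\in\mathcal X$) and $\nabla^2 f(x)$ its (symmetric) Hessian at $x\in\mathcal X$. The set $\arg\min_{x\in\mathcal X}f(x)$ is nonempty and $x^\ast$ is an element of it. Second-order smoothness with modulus $L>0$: $\|\nabla^2 f(x)-\nabla^2 f(x')\|\le L\|x-x'\|$ for all $x,x'\in\mathcal X$, and the second-order Taylor expansion $f(x)=f(x')+\langle\nabla f(x'),x-x'\rangle+\frac12\langle\nabla^2f(x')(x-x'),x-x'\rangle+O(\|x-x'\|^3)$ holds; in particular $\|\nabla f(x)-\nabla f(x')-\nabla^2 f(x')(x-x')\|\le\frac L2\|x-x'\|^2$ for all $x,x'\in\mathcal X$. Oracles. $g(x,\xi)\in\mathbb R^d$ and $H(x,\xi)\in\mathbb R^{d\times d}$ (symmetric) are a stochastic gradient and Hessian, such that for every $x\in\mathcal X$ (and $\xi$ independent of $x$): $\mathbb E[g(x,\xi)\mid x]=\nabla f(x)$, $\mathbb E[\|g(x,\xi)-\nabla f(x)\|^2\mid x]\le\sigma_g^2$, $\mathbb E[H(x,\xi)\mid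 x]=\nabla^2f(x)$, $\mathbb E[\|H(x,\xi)-\nabla^2f(x)\|^2\mid x]\le\sigma_H^2$. Set $$\tilde{\mathbf F}(x;x',\xi)=g(x',\xi)+H(x',\xi)(x-x').$$ Extra-Newton algorithm. Let $X_1\in\mathcal X$, let $\xi_1,\xi_{3/2},\xi_2,\xi_{5/2},\dots$ be i.i.d. samples, and let $B_t=\sum_{s=1}^t b_s$. Define $$\tilde X_t=\frac{b_tX_t+\sum_{s=1}^{t-1}b_sX_{s+1/2}}{B_t},\qquad \bar X_{t+1/2}=\frac{\sum_{s=1}^{t}b_sX_{s+1/2}}{B_t}.$$ For $t=1,\dots,T$ the iterates are (any measurably selected minimizers) $$X_{t+1/2}\in\arg\min_{x\in\mathcal X}\ \langle a_tg(\tilde X_t,\xi_t),x\rangle+\frac{a_tb_t}{2B_t}\langle H(\tilde X_t,\xi_t)(x-X_t),x-X_t\rangle+\frac1{2\gamma_t}\|x-X_t\|^2,$$ $$X_{t+1}=\arg\min_{x\in\mathcal X}\ \langle a_tg(\bar X_{t+1/2},\xi_{t+1/2}),x\rangle+\frac1{2\gamma_t}\|x-X_t\|^2.$$ *)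

theory Defs
  imports "HOL-Analysis.Analysis" "HOL-Probability.Probability"
begin

section \<open>Objective function\<close>

definition proper_fun :: "('v \<Rightarrow> ereal) \<Rightarrow> bool" where
  "proper_fun f \<longleftrightarrow> (\<forall>x. f x \<noteq> -\<infinity>) \<and> (\<exists>x. f x \<noteq> \<infinity>)"

definition lower_semicontinuous :: "('v::topological_space \<Rightarrow> ereal) \<Rightarrow> bool" where
  "lower_semicontinuous f \<longleftrightarrow> (\<forall>x. f x \<le> Liminf (at x) f)"

definition convex_fun :: "('v::real_vector \<Rightarrow> ereal) \<Rightarrow> bool" where
  "convex_fun f \<longleftrightarrow>
     (\<forall>x y. \<forall>u\<in>{0<..<1}. f ((1 - u) *\<^sub>R x + u *\<^sub>R y) \<le> ereal (1 - u) * f x + ereal u * f y)"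

text \<open>
  Derivatives are taken relative to the feasible set, because \<open>f\<close> may be infinite outside of it.
  Wherever \<open>f\<close> is differentiable in the ordinary sense, the ordinary gradient and Hessian qualify.
\<close>

definition is_gradient_on ::
    "('v::real_inner) set \<Rightarrow> ('v \<Rightarrow> ereal) \<Rightarrow> ('v \<Rightarrow> 'v) \<Rightarrow> bool" where
  "is_gradient_on S f gf \<longleftrightarrow>
     (\<forall>x\<in>S. ((\<lambda>y. real_of_ereal (f y)) has_derivative (\<lambda>h. gf x \<bullet> h)) (at x within S))"

definition is_hessian_on ::
    "(real^'n) set \<Rightarrow> (real^'n \<Rightarrow> real^'n) \<Rightarrow> (real^'n \<Rightarrow> real^'n^'n) \<Rightarrow> bool" where
  "is_hessian_on S gf Hf \<longleftrightarrow>
     (\<forall>x\<in>S. (gf has_derivative (\<lambda>h. Hf x *v h)) (at x within S) \<and> transpose (Hf x) = Hf x)"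

definition op_norm :: "real^'n^'n \<Rightarrow> real" where
  "op_norm A = onorm (\<lambda>v. A *v v)"

definition second_order_smooth ::
    "(real^'n) set \<Rightarrow> (real^'n \<Rightarrow> ereal) \<Rightarrow> (real^'n \<Rightarrow> real^'n) \<Rightarrow> (real^'n \<Rightarrow> real^'n^'n) \<Rightarrow>
     real \<Rightarrow> bool" where
  "second_order_smooth S f gf Hf L \<longleftrightarrow>
     L > 0 \<and>
     (\<forall>x\<in>S. \<forall>x'\<in>S. op_norm (Hf x - Hf x') \<le> L * norm (x - x')) \<and>
     (\<exists>K. \<forall>x\<in>S. \<forall>x'\<in>S.
        \<bar>real_of_ereal (f x) - (real_of_ereal (f x') + gf x' \<bullet> (x - x')
           + 1/2 * ((Hf x' *v (x - x')) \<bullet> (x - x')))\<bar> \<le> K * norm (x - x') ^ 3)"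

section \<open>Stochastic oracles\<close>

text \<open>
  \<open>P\<close> is the law of a single sample.  Since a sample is independent of the query point, the
  conditional expectation given the query point \<open>x\<close> is the \<open>P\<close>-integral with \<open>x\<close> held fixed.  Joint
  measurability makes the oracle answers at random query points random variables.
\<close>

definition gradient_oracle ::
    "(real^'n) set \<Rightarrow> 's measure \<Rightarrow> (real^'n \<Rightarrow> real^'n) \<Rightarrow> real \<Rightarrow> (real^'n \<Rightarrow> 's \<Rightarrow> real^'n) \<Rightarrow> bool"
  where
  "gradient_oracle S P gf \<sigma>g g \<longleftrightarrow>
     (\<lambda>(x, s). g x s) \<in> borel_measurable (restrict_space borel S \<Otimes>\<^sub>M P) \<and>
     (\<forall>x\<in>S.
        integrable P (g x) \<and> (\<integral>s. g x s \<partial>P) = gf x \<and>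
        integrable P (\<lambda>s. (norm (g x s - gf x))\<^sup>2) \<and>
        (\<integral>s. (norm (g x s - gf x))\<^sup>2 \<partial>P) \<le> \<sigma>g\<^sup>2)"

definition hessian_oracle ::
    "(real^'n) set \<Rightarrow> 's measure \<Rightarrow> (real^'n \<Rightarrow> real^'n^'n) \<Rightarrow> real \<Rightarrow> (real^'n \<Rightarrow> 's \<Rightarrow> real^'n^'n) \<Rightarrow>
     bool"
  where
  "hessian_oracle S P Hf \<sigma>H H \<longleftrightarrow>
     (\<lambda>(x, s). H x s) \<in> borel_measurable (restrict_space borel S \<Otimes>\<^sub>M P) \<and>
     (\<forall>x\<in>S.
        (\<forall>s\<in>space P. transpose (H x s) = H x s) \<and>
        integrable P (H x) \<and> (\<integral>s. H x s \<partial>P) = Hf x \<and>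
        integrable P (\<lambda>s. (op_norm (H x s - Hf x))\<^sup>2) \<and>
        (\<integral>s. (op_norm (H x s - Hf x))\<^sup>2 \<partial>P) \<le> \<sigma>H\<^sup>2)"

definition F_tilde ::
    "(real^'n \<Rightarrow> 's \<Rightarrow> real^'n) \<Rightarrow> (real^'n \<Rightarrow> 's \<Rightarrow> real^'n^'n) \<Rightarrow>
     real^'n \<Rightarrow> real^'n \<Rightarrow> 's \<Rightarrow> real^'n" where
  "F_tilde g H x x' s = g x' s + H x' s *v (x - x')"

section \<open>The Extra-Newton algorithm\<close>

text \<open>
  For a single realisation, \<open>z\<close>, \<open>X\<close> and \<open>Y\<close> hold the samples and the iterates.  Half-integer
  indices are encoded as follows: \<open>z k\<close> is the sample \<open>\<xi>\<close> with index \<open>k/2\<close>, so that \<open>z (2 * t)\<close> is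
  the sample at \<open>t\<close> and \<open>z (2 * t + 1)\<close> the sample at \<open>t + 1/2\<close>; \<open>X t\<close> is the iterate at \<open>t\<close> and
  \<open>Y t\<close> the iterate at \<open>t + 1/2\<close>.  All sequences start at \<open>t = 1\<close>.
\<close>

definition cum_weight :: "(nat \<Rightarrow> real) \<Rightarrow> nat \<Rightarrow> real" where
  "cum_weight b t = (\<Sum>s=1..t. b s)"

definition X_tilde ::
    "(nat \<Rightarrow> real) \<Rightarrow> (nat \<Rightarrow> 'v::real_vector) \<Rightarrow> (nat \<Rightarrow> 'v) \<Rightarrow> nat \<Rightarrow> 'v" where
  "X_tilde b X Y t = (b t *\<^sub>R X t + (\<Sum>s=1..<t. b s *\<^sub>R Y s)) /\<^sub>R cum_weight b t"

definition X_bar :: "(nat \<Rightarrow> real) \<Rightarrow> (nat \<Rightarrow> 'v::real_vector) \<Rightarrow> nat \<Rightarrow> 'v" where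
  "X_bar b Y t = (\<Sum>s=1..t. b s *\<^sub>R Y s) /\<^sub>R cum_weight b t"

definition step_size ::
    "(real^'n \<Rightarrow> 's \<Rightarrow> real^'n) \<Rightarrow> (real^'n \<Rightarrow> 's \<Rightarrow> real^'n^'n) \<Rightarrow> (nat \<Rightarrow> real) \<Rightarrow> (nat \<Rightarrow> real) \<Rightarrow>
     real \<Rightarrow> real \<Rightarrow> (nat \<Rightarrow> 's) \<Rightarrow> (nat \<Rightarrow> real^'n) \<Rightarrow> (nat \<Rightarrow> real^'n) \<Rightarrow> nat \<Rightarrow> real" where
  "step_size g H a b \<gamma> \<beta>0 z X Y t =
     \<gamma> / sqrt (\<beta>0 + (\<Sum>s=1..<t. (a s)\<^sup>2 *
        (norm (g (X_bar b Y s) (z (2 * s + 1))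
               - F_tilde g H (X_bar b Y s) (X_tilde b X Y s) (z (2 * s))))\<^sup>2))"

definition extra_newton_run ::
    "(real^'n) set \<Rightarrow> (real^'n \<Rightarrow> 's \<Rightarrow> real^'n) \<Rightarrow> (real^'n \<Rightarrow> 's \<Rightarrow> real^'n^'n) \<Rightarrow>
     (nat \<Rightarrow> real) \<Rightarrow> (nat \<Rightarrow> real) \<Rightarrow> real \<Rightarrow> real \<Rightarrow> nat \<Rightarrow> real^'n \<Rightarrow>
     (nat \<Rightarrow> 's) \<Rightarrow> (nat \<Rightarrow> real^'n) \<Rightarrow> (nat \<Rightarrow> real^'n) \<Rightarrow> bool" where
  "extra_newton_run S g H a b \<gamma> \<beta>0 T x1 z X Y \<longleftrightarrow>
     X 1 = x1 \<and>
     (\<forall>t\<in>{1..T}. let \<gamma>t = step_size g H a b \<gamma> \<beta>0 z X Y t in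
        is_arg_min
          (\<lambda>x. (a t *\<^sub>R g (X_tilde b X Y t) (z (2 * t))) \<bullet> x
             + a t * b t / (2 * cum_weight b t)
                 * ((H (X_tilde b X Y t) (z (2 * t)) *v (x - X t)) \<bullet> (x - X t))
             + 1 / (2 * \<gamma>t) * (norm (x - X t))\<^sup>2)
          (\<lambda>x. x \<in> S) (Y t) \<and>
        is_arg_min
          (\<lambda>x. (a t *\<^sub>R g (X_bar b Y t) (z (2 * t + 1))) \<bullet> x
             + 1 / (2 * \<gamma>t) * (norm (x - X t))\<^sup>2)
          (\<lambda>x. x \<in> S) (X (t + 1)))"

text \<open>
  The first subproblem need not have a unique solution, since the stochastic Hessian may be
  indefinite.  A measurable selection of \<open>Y t\<close> has to be measurable with respect to the samples
  drawn so far, i.e. those with indices \<open>1, 3/2, \<dots>, t\<close>.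
\<close>

definition sample_history ::
    "'w measure \<Rightarrow> 's measure \<Rightarrow> (nat \<Rightarrow> 'w \<Rightarrow> 's) \<Rightarrow> nat \<Rightarrow> 'w measure" where
  "sample_history M P \<xi> t =
     vimage_algebra (space M) (\<lambda>\<omega>. \<lambda>k\<in>{2..2*t}. \<xi> k \<omega>) (\<Pi>\<^sub>M k\<in>{2..2*t}. P)"

definition iid_samples :: "'w measure \<Rightarrow> 's measure \<Rightarrow> (nat \<Rightarrow> 'w \<Rightarrow> 's) \<Rightarrow> bool" where
  "iid_samples M P \<xi> \<longleftrightarrow>
     prob_space M \<and> prob_space P \<and>
     prob_space.indep_vars M (\<lambda>_. P) \<xi> {2..} \<and>
     (\<forall>k\<ge>2. distr M P (\<xi> k) = P)"

section \<open>The constant\<close>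

text \<open>
  The constant hidden in \<open>O(\<cdot>)\<close> may depend on \<open>p\<close> only; in particular it must be the same for all
  dimensions and all sample spaces.  These are types, over which an existential quantifier cannot
  be made uniform, hence a concrete function of \<open>p\<close> is fixed.  The value is not optimised.
\<close>

definition rate_const :: "real \<Rightarrow> real" where
  "rate_const p = 100 * (p + 1) ^ 3"

end

theory Submission
  imports Defs
begin

text \<open>
  Write \<open>A = (D\<^sup>2 + \<gamma>\<^sup>2) / \<gamma>\<close>, \<open>\<Gamma>\<^sub>t = \<gamma> / \<gamma>\<^sub>t\<close>, and \<open>G\<^sub>t\<close> for the stochastic gradient at the average
  \<open>xb\<^sub>t\<close> of \<open>Y\<^sub>1, \<dots>, Y\<^sub>t\<close>; let \<open>F\<^sub>t\<close> be its prediction by the stochastic linear model built at the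
  earlier point \<open>xt\<^sub>t\<close>.  The bound combines three deterministic estimates with one moment estimate.

  Averaging.  Since \<open>b\<^sub>t (Y\<^sub>t - xb\<^sub>t) = B\<^sub>t\<^sub>-\<^sub>1 (xb\<^sub>t - xb\<^sub>t\<^sub>-\<^sub>1)\<close>, convexity turns each term
  \<open>a\<^sub>t \<nabla>f(xb\<^sub>t) \<bullet> (Y\<^sub>t - x\<^sup>*)\<close> into a difference of suboptimality gaps.  As \<open>a\<^sub>t / b\<^sub>t = t\<^sup>2\<^sup>-\<^sup>p\<close> does not
  increase, the sum over \<open>t\<close> dominates \<open>a\<^sub>T B\<^sub>T / b\<^sub>T\<close> times the final gap, and this factor is at
  least \<open>T\<^sup>3 / (p + 1)\<close> (\<open>weighted_online_to_batch\<close>).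

  Regret.  From \<open>xb\<^sub>t - xt\<^sub>t = (b\<^sub>t / B\<^sub>t) (Y\<^sub>t - X\<^sub>t)\<close> it follows that the optimality condition of the
  quadratic subproblem is that of an extragradient step with direction \<open>F\<^sub>t\<close>.  Hence the noisy
  regret is at most \<open>A \<Gamma>\<^sub>T\<^sub>+\<^sub>1 - (\<Sum>t. \<Gamma>\<^sub>t / (2 \<gamma>) \<parallel>X\<^sub>t - Y\<^sub>t\<parallel>\<^sup>2)\<close> (\<open>extragradient_potential_step\<close>).

  Self-bounding.  The increments of \<open>\<Gamma>\<^sup>2\<close> are the squared weighted prediction errors
  \<open>a\<^sub>t\<^sup>2 \<parallel>G\<^sub>t - F\<^sub>t\<parallel>\<^sup>2\<close>, made of noise and of a Taylor remainder of weighted size at most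
  \<open>(L / 2) (p + 1)\<^sup>2 \<parallel>X\<^sub>t - Y\<^sub>t\<parallel>\<^sup>2\<close>.  The remainder is fed by the same distances that occur with a
  negative sign in the regret: until \<open>\<Gamma>\<close> exceeds a threshold of order \<open>L D sqrt (D\<^sup>2 + \<gamma>\<^sup>2)\<close> it has
  cost no more than the threshold, and afterwards the negative terms absorb it.  What is left are
  \<open>A sqrt \<beta>\<^sub>0\<close>, the noise, and a quantity independent of \<open>T\<close> (\<open>adaptive_threshold\<close>).

  Moments.  The noise in \<open>\<Gamma>\<^sub>T\<^sub>+\<^sub>1\<close> is a Euclidean norm over the steps, so by Jensen its expectation is at
  most \<open>2 \<sigma>\<^sub>g T\<^sup>2 sqrt T + (p + 1) D \<sigma>\<^sub>H T sqrt T\<close>.  The difference between true and noisy regret is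
  centred, because \<open>xb\<^sub>t\<close> and \<open>Y\<^sub>t\<close> are functions of the samples preceding the one in \<open>G\<^sub>t\<close>
  (\<open>fresh_sample_unbiased\<close>).  Division by \<open>T\<^sup>3 / (p + 1)\<close> gives the three terms of the rate.
\<close>

section \<open>First-order calculus on the feasible set\<close>

lemma norm_matrix_vector_le: "norm (A *v v) \<le> op_norm A * norm (v :: real^'n)" for A :: "real^'n^'n"
  unfolding op_norm_def by (rule onorm) (rule matrix_vector_mul_bounded_linear)

lemma op_norm_nonneg: "0 \<le> op_norm A"
  unfolding op_norm_def by (rule onorm_pos_le) (rule matrix_vector_mul_bounded_linear)

text \<open>
  The derivative is only taken within \<open>S\<close>, so the tangent inequality comes from the difference
  quotients along the segment from \<open>x\<close> to \<open>y\<close>: convexity bounds them by \<open>f y - f x\<close>, and they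
  tend to \<open>gf x \<bullet> (y - x)\<close> as the segment parameter decreases to zero.
\<close>

lemma convex_fun_above_tangent:
  fixes f :: "'v::euclidean_space \<Rightarrow> ereal"
  assumes "convex S" "convex_fun f" and fin: "\<And>x. x \<in> S \<Longrightarrow> \<bar>f x\<bar> \<noteq> \<infinity>"
    and gf: "is_gradient_on S f gf" and x: "x \<in> S" and y: "y \<in> S"
  shows "real_of_ereal (f x) + gf x \<bullet> (y - x) \<le> real_of_ereal (f y)"
proof -
  define \<phi> where "\<phi> u = real_of_ereal (f (x + u *\<^sub>R (y - x)))" for u
  have seg: "x + u *\<^sub>R (y - x) \<in> S" if "u \<in> {0..1}" for u
    using convexD_alt[OF \<open>convex S\<close> x y, of u] that by (simp add: algebra_simps)
  have "((\<lambda>y. real_of_ereal (f y)) has_derivative (\<lambda>h. gf x \<bullet> h)) (at (x + 0 *\<^sub>R (y - x)) within (\<lambda>u. x + u *\<^sub>R (y - x)) ` {0..1})"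
    using gf x seg unfolding is_gradient_on_def by (auto intro: has_derivative_subset)
  then have "((\<lambda>y. real_of_ereal (f y)) \<circ> (\<lambda>u. x + u *\<^sub>R (y - x)) has_derivative (\<lambda>h. gf x \<bullet> h) \<circ> (\<lambda>u. u *\<^sub>R (y - x))) (at 0 within {0..1})"
    by (intro diff_chain_within) (auto intro!: derivative_eq_intros)
  then have "(\<phi> has_real_derivative (gf x \<bullet> (y - x))) (at 0 within {0..1})"
    by (simp add: has_field_derivative_def o_def \<phi>_def[abs_def] mult_commute_abs)
  then have lim: "((\<lambda>u. (\<phi> u - \<phi> 0) / (u - 0)) \<longlongrightarrow> gf x \<bullet> (y - x)) (at 0 within {0..1})"
    by (simp add: has_field_derivative_iff)
  have "(\<phi> u - \<phi> 0) / (u - 0) \<le> \<phi> 1 - \<phi> 0" if u: "0 < u" "u < 1" for u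
  proof -
    have "f ((1 - u) *\<^sub>R x + u *\<^sub>R y) \<le> ereal (1 - u) * f x + ereal u * f y"
      using assms(2) u unfolding convex_fun_def by auto
    moreover obtain r r' r'' where "f x = ereal r" "f y = ereal r'" "f (x + u *\<^sub>R (y - x)) = ereal r''"
      using fin[OF x] fin[OF y] fin[OF seg[of u]] u by (metis atLeastAtMost_iff ereal_real' less_eq_real_def)
    ultimately have "\<phi> u \<le> (1 - u) * \<phi> 0 + u * \<phi> 1"
      by (simp add: \<phi>_def algebra_simps)
    then show ?thesis using u by (simp add: field_simps)
  qed
  moreover have "eventually (\<lambda>u. 0 < u \<and> u < 1) (at 0 within {0..1::real})"
    unfolding eventually_at by (intro exI[of _ 1]) (auto simp: dist_real_def)
  ultimately have "eventually (\<lambda>u. (\<phi> u - \<phi> 0) / (u - 0) \<le> \<phi> 1 - \<phi> 0) (at 0 within {0..1})"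
    by (auto elim: eventually_mono)
  then have "gf x \<bullet> (y - x) \<le> \<phi> 1 - \<phi> 0"
    by (intro tendsto_upperbound[OF lim]) (auto simp: trivial_limit_within islimpt_Icc)
  then show ?thesis by (simp add: \<phi>_def)
qed

text \<open>
  Along the segment \<open>c u = x + u (y - x)\<close> the function \<open>u \<mapsto> gf (c u) - u Hf(x) (y - x)\<close> has a
  derivative of norm at most \<open>L u \<parallel>y - x\<parallel>\<^sup>2\<close>; integrating over \<open>[0, 1]\<close> gives the factor \<open>L / 2\<close>.
\<close>

lemma gradient_taylor_bound:
  fixes gf :: "real^'n \<Rightarrow> real^'n"
  assumes "convex S" and Hf: "is_hessian_on S gf Hf"
    and lip: "\<And>x x'. x \<in> S \<Longrightarrow> x' \<in> S \<Longrightarrow> op_norm (Hf x - Hf x') \<le> L * norm (x - x')"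
    and x: "x \<in> S" and y: "y \<in> S"
  shows "norm (gf y - gf x - Hf x *v (y - x)) \<le> L / 2 * (norm (y - x))\<^sup>2"
proof -
  define v where "v = y - x"
  define c where "c u = x + u *\<^sub>R v" for u
  define h where "h u = gf (c u) - u *\<^sub>R (Hf x *v v)" for u
  have seg: "c u \<in> S" if "u \<in> {0..1}" for u
    using convexD_alt[OF \<open>convex S\<close> x y, of u] that by (simp add: c_def v_def algebra_simps)
  have dgf: "((\<lambda>u. gf (c u)) has_vector_derivative (Hf (c u) *v v)) (at u within {0..1})"
    if u: "u \<in> {0..1}" for u
  proof -
    have "(gf has_derivative (\<lambda>h. Hf (c u) *v h)) (at (c u) within c ` {0..1})"
    proof (rule has_derivative_subset)
      show "(gf has_derivative (\<lambda>h. Hf (c u) *v h)) (at (c u) within S)"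
        using Hf seg[OF u] unfolding is_hessian_on_def by blast
      show "c ` {0..1} \<subseteq> S" using seg by blast
    qed
    then have "(gf \<circ> c has_derivative (\<lambda>h. Hf (c u) *v h) \<circ> (\<lambda>h. h *\<^sub>R v)) (at u within {0..1})"
      by (intro diff_chain_within) (auto simp: c_def[abs_def] intro!: derivative_eq_intros)
    then show ?thesis
      by (simp add: has_vector_derivative_def o_def matrix_vector_mult_scaleR)
  qed
  have dh: "(h has_vector_derivative (Hf (c u) *v v - Hf x *v v)) (at u within {0..1})"
    if u: "u \<in> {0..1}" for u
    unfolding h_def[abs_def] using dgf[OF u]
    by (auto intro!: derivative_eq_intros)
  have "norm (h 1 - h 0) \<le> L / 2 * (norm v)\<^sup>2 * 1\<^sup>2 - L / 2 * (norm v)\<^sup>2 * 0\<^sup>2"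
  proof (rule differentiable_bound_general[where f = h and f' = "\<lambda>u. Hf (c u) *v v - Hf x *v v"
      and \<phi> = "\<lambda>u. L / 2 * (norm v)\<^sup>2 * u\<^sup>2" and \<phi>' = "\<lambda>u. L * (norm v)\<^sup>2 * u"])
    show "continuous_on {0..1} h"
      using dh has_vector_derivative_continuous by (metis continuous_on_eq_continuous_within)
    show "(h has_vector_derivative (Hf (c u) *v v - Hf x *v v)) (at u)" if "0 < u" "u < 1" for u
      using dh[of u] that by (simp add: at_within_Icc_at)
    show "norm (Hf (c u) *v v - Hf x *v v) \<le> L * (norm v)\<^sup>2 * u" if u: "0 < u" "u < 1" for u
    proof -
      have "norm (Hf (c u) *v v - Hf x *v v) \<le> op_norm (Hf (c u) - Hf x) * norm v"
        by (metis norm_matrix_vector_le matrix_vector_mult_diff_rdistrib)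
      also have "\<dots> \<le> (L * norm (c u - x)) * norm v"
        using lip[OF seg x, of u] u by (intro mult_right_mono) auto
      also have "\<dots> = L * (norm v)\<^sup>2 * u"
        using u by (simp add: c_def power2_eq_square)
      finally show ?thesis .
    qed
    show "continuous_on {0..1} (\<lambda>u. L / 2 * (norm v)\<^sup>2 * u\<^sup>2)"
      by (intro continuous_intros)
    show "((\<lambda>u. L / 2 * (norm v)\<^sup>2 * u\<^sup>2) has_vector_derivative L * (norm v)\<^sup>2 * u) (at u)" for u
      by (auto intro!: derivative_eq_intros simp: has_real_derivative_iff_has_vector_derivative[symmetric])
  qed auto
  then show ?thesis
    by (simp add: h_def c_def v_def algebra_simps)
qed

lemma linear_coeff_nonneg:
  fixes l q :: real
  assumes "\<And>u. 0 < u \<Longrightarrow> u \<le> 1 \<Longrightarrow> 0 \<le> u * l + u\<^sup>2 * q"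
  shows "0 \<le> l"
proof (rule ccontr)
  assume "\<not> 0 \<le> l"
  \<comment> \<open>A step so short that the quadratic term cannot compensate a negative linear one.\<close>
  define u where "u = min 1 (- l / (2 * (\<bar>q\<bar> + 1)))"
  have u: "0 < u" "u \<le> 1" using \<open>\<not> 0 \<le> l\<close> by (auto simp: u_def field_simps)
  have "u * (\<bar>q\<bar> + 1) \<le> - l / 2" 
  proof -
    have "u \<le> - l / (2 * (\<bar>q\<bar> + 1))" by (simp add: u_def)
    then show ?thesis by (subst (asm) pos_le_divide_eq) (auto simp: algebra_simps)
  qed
  moreover have "u * q \<le> u * (\<bar>q\<bar> + 1)" using u by (intro mult_left_mono) auto
  ultimately have "l + u * q < 0" using \<open>\<not> 0 \<le> l\<close> by linarith
  then have "u * (l + u * q) < 0" using u by (simp add: mult_pos_neg)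
  with assms[OF u] show False by (simp add: power2_eq_square algebra_simps)
qed

text \<open>
  Moving from the minimiser towards \<open>x\<close> changes the objective by a quadratic polynomial in the
  step without constant term, whose linear coefficient must be nonnegative.  The argument covers
  indefinite forms \<open>A\<close>, which stochastic Hessians may be.
\<close>

lemma arg_min_quadratic_first_order:
  fixes w c :: "real^'n" and A :: "real^'n^'n"
  assumes "convex S" and A: "transpose A = A"
    and min: "is_arg_min (\<lambda>x. w \<bullet> x + \<kappa> / 2 * ((A *v (x - c)) \<bullet> (x - c)) + 1 / (2 * \<eta>) * (norm (x - c))\<^sup>2)
      (\<lambda>x. x \<in> S) m"
    and x: "x \<in> S"
  shows "0 \<le> (w + \<kappa> *\<^sub>R (A *v (m - c)) + (1 / \<eta>) *\<^sub>R (m - c)) \<bullet> (x - m)"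
proof (rule linear_coeff_nonneg)
  fix u :: real assume u: "0 < u" "u \<le> 1"
  let ?q = "\<lambda>x. w \<bullet> x + \<kappa> / 2 * ((A *v (x - c)) \<bullet> (x - c)) + 1 / (2 * \<eta>) * (norm (x - c))\<^sup>2"
  have m: "m \<in> S" using min by (simp add: is_arg_min_def)
  have sym: "(A *v v) \<bullet> w = (A *v w) \<bullet> v" for v w
    by (metis A dot_lmul_matrix inner_commute transpose_matrix_vector)
  have "m + u *\<^sub>R (x - m) \<in> S"
    using convexD_alt[OF \<open>convex S\<close> m x, of u] u by (simp add: algebra_simps)
  then have "?q m \<le> ?q (m + u *\<^sub>R (x - m))"
    using min by (auto simp: is_arg_min_linorder)
  moreover define v e where "v = x - m" and "e = m - c"
  moreover have "m + u *\<^sub>R v - c = e + u *\<^sub>R v" by (simp add: e_def)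
  ultimately have "w \<bullet> m + \<kappa> / 2 * ((A *v e) \<bullet> e) + 1 / (2 * \<eta>) * (norm e)\<^sup>2
    \<le> w \<bullet> (m + u *\<^sub>R v) + \<kappa> / 2 * ((A *v (e + u *\<^sub>R v)) \<bullet> (e + u *\<^sub>R v)) + 1 / (2 * \<eta>) * (norm (e + u *\<^sub>R v))\<^sup>2"
    by (simp only:)
  also have "(A *v (e + u *\<^sub>R v)) \<bullet> (e + u *\<^sub>R v) = (A *v e) \<bullet> e + 2 * u * ((A *v e) \<bullet> v) + u\<^sup>2 * ((A *v v) \<bullet> v)"
    by (simp add: matrix_vector_right_distrib matrix_vector_mult_scaleR inner_add_left inner_add_right
        sym[of v e] power2_eq_square algebra_simps)
  also have "(norm (e + u *\<^sub>R v))\<^sup>2 = (norm e)\<^sup>2 + 2 * u * (e \<bullet> v) + u\<^sup>2 * (norm v)\<^sup>2"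
    unfolding power2_norm_eq_inner
    by (simp add: inner_add_left inner_add_right inner_commute power2_eq_square algebra_simps)
  finally have "0 \<le> u * (w \<bullet> v + \<kappa> * ((A *v e) \<bullet> v) + (e \<bullet> v) / \<eta>)
      + u\<^sup>2 * (\<kappa> / 2 * ((A *v v) \<bullet> v) + (norm v)\<^sup>2 / (2 * \<eta>))"
    by (simp add: inner_add_right algebra_simps add_divide_distrib)
  then show "0 \<le> u * ((w + \<kappa> *\<^sub>R (A *v (m - c)) + (1 / \<eta>) *\<^sub>R (m - c)) \<bullet> (x - m))
      + u\<^sup>2 * (\<kappa> / 2 * ((A *v (x - m)) \<bullet> (x - m)) + (norm (x - m))\<^sup>2 / (2 * \<eta>))"
    by (simp add: v_def e_def inner_add_left)
qed

text \<open>
  Completing the square identifies the second subproblem with a projection, hence the iterate is a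
  continuous function of its data.
\<close>

lemma arg_min_proximal_eq_closest_point:
  fixes S :: "'v::euclidean_space set"
  assumes "convex S" "closed S" "\<eta> > 0"
    and "is_arg_min (\<lambda>x. w \<bullet> x + 1 / (2 * \<eta>) * (norm (x - c))\<^sup>2) (\<lambda>x. x \<in> S) m"
  shows "m = closest_point S (c - \<eta> *\<^sub>R w)"
proof (rule closest_point_unique[OF assms(1,2)])
  have expand: "(dist (c - \<eta> *\<^sub>R w) x)\<^sup>2
      = 2 * \<eta> * (w \<bullet> x + 1 / (2 * \<eta>) * (norm (x - c))\<^sup>2) + (\<eta>\<^sup>2 * (norm w)\<^sup>2 - 2 * \<eta> * (w \<bullet> c))" for x
  proof -
    have "2 * \<eta> * (w \<bullet> x + 1 / (2 * \<eta>) * (norm (x - c))\<^sup>2) = 2 * \<eta> * (w \<bullet> x) + (norm (x - c))\<^sup>2"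
      using \<open>\<eta> > 0\<close> by (simp add: distrib_left)
    then show ?thesis
      unfolding dist_norm power2_norm_eq_inner
      by (simp add: inner_diff_left inner_diff_right inner_commute algebra_simps power2_eq_square)
  qed
  show "m \<in> S" using assms(4) by (simp add: is_arg_min_def)
  show "\<forall>z\<in>S. dist (c - \<eta> *\<^sub>R w) m \<le> dist (c - \<eta> *\<^sub>R w) z"
  proof
    fix z assume "z \<in> S"
    then have "w \<bullet> m + 1 / (2 * \<eta>) * (norm (m - c))\<^sup>2 \<le> w \<bullet> z + 1 / (2 * \<eta>) * (norm (z - c))\<^sup>2"
      using assms(4) by (auto simp: is_arg_min_linorder)
    then have "(dist (c - \<eta> *\<^sub>R w) m)\<^sup>2 \<le> (dist (c - \<eta> *\<^sub>R w) z)\<^sup>2"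
      unfolding expand using \<open>\<eta> > 0\<close> by (intro add_right_mono mult_left_mono) auto
    then show "dist (c - \<eta> *\<^sub>R w) m \<le> dist (c - \<eta> *\<^sub>R w) z"
      by (rule power2_le_imp_le) simp
  qed
qed

section \<open>Weighted averages of the iterates\<close>

text \<open>
  A power sum dominates the corresponding integral; increments are compared by the mean value theorem.
\<close>

lemma powr_le_cum_weight:
  fixes p :: real
  assumes "p \<ge> 0"
  shows "real t powr (p + 1) \<le> (p + 1) * cum_weight (\<lambda>s. real s powr p) t"
proof (induction t)
  case 0
  then show ?case by (simp add: cum_weight_def)
next
  case (Suc t)
  have "real (Suc t) powr (p + 1) - real t powr (p + 1) \<le> (p + 1) * real (Suc t) powr p"
  proof (cases "t = 0")
    case True
    then show ?thesis using assms by simp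
  next
    case False
    have "\<exists>z>real t. z < real (Suc t) \<and>
        real (Suc t) powr (p + 1) - real t powr (p + 1) = (real (Suc t) - real t) * ((p + 1) * z powr p)"
      by (rule MVT2) (use False in \<open>auto intro!: derivative_eq_intros simp: powr_diff\<close>)
    then obtain z where z: "z > real t" "z < real (Suc t)"
      "real (Suc t) powr (p + 1) - real t powr (p + 1) = (p + 1) * z powr p"
      by auto
    have "z powr p \<le> real (Suc t) powr p"
      using z assms by (intro powr_mono2) auto
    then show ?thesis
      unfolding z(3) using assms by (intro mult_left_mono) auto
  qed
  with Suc show ?case
    by (simp add: cum_weight_def algebra_simps)
qed

text \<open>
  Multiplied by \<open>a t = t\<^sup>2\<close>, the square of this bound is constant in \<open>t\<close>: the weighted Taylor remainder
  does not grow along the run.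
\<close>

lemma weight_ratio_le:
  assumes "p \<ge> 0" "t \<ge> 1"
  shows "real t powr p / cum_weight (\<lambda>s. real s powr p) t \<le> (p + 1) / real t"
proof -
  have B: "cum_weight (\<lambda>s. real s powr p) t > 0"
    unfolding cum_weight_def using assms by (intro sum_pos) auto
  have "real t powr p * real t \<le> (p + 1) * cum_weight (\<lambda>s. real s powr p) t"
    using powr_le_cum_weight[OF assms(1), of t] assms(2) by (simp add: powr_add)
  then show ?thesis using B assms by (simp add: field_simps)
qed

lemma X_bar_mem:
  assumes "convex S" "\<And>s. s \<in> {1..t} \<Longrightarrow> Y s \<in> S" "\<And>s. s \<in> {1..t} \<Longrightarrow> b s > 0" "t \<ge> 1"
  shows "X_bar b Y t \<in> S"
proof -
  have B: "cum_weight b t > 0"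
    unfolding cum_weight_def using assms by (intro sum_pos) auto
  have "X_bar b Y t = (\<Sum>s=1..t. (b s / cum_weight b t) *\<^sub>R Y s)"
    by (simp add: X_bar_def scaleR_sum_right divide_inverse mult.commute)
  also have "\<dots> \<in> S"
    using assms B by (intro convex_sum) (auto simp: sum_divide_distrib[symmetric] cum_weight_def less_imp_le)
  finally show ?thesis .
qed

text \<open>
  The prediction point is the average in which the last iterate \<open>Y t\<close> is replaced by \<open>X t\<close>.
\<close>

lemma X_tilde_eq_X_bar:
  assumes "t \<ge> 1"
  shows "X_tilde b X Y t = X_bar b (Y(t := X t)) t"
proof -
  have "{1..t} = insert t {1..<t}" using assms by auto
  then show ?thesis by (simp add: X_tilde_def X_bar_def)
qed

lemma X_tilde_mem:
  assumes "convex S" "X t \<in> S" "\<And>s. s \<in> {1..<t} \<Longrightarrow> Y s \<in> S"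
    "\<And>s. s \<in> {1..t} \<Longrightarrow> b s > 0" "t \<ge> 1"
  shows "X_tilde b X Y t \<in> S"
  unfolding X_tilde_eq_X_bar[OF \<open>t \<ge> 1\<close>] using assms by (intro X_bar_mem) auto

text \<open>
  This identity gives the factor \<open>b t / B t\<close> in the quadratic subproblem its meaning: the Hessian
  term of the subproblem is the linear correction of the gradient from \<open>xt\<close> to \<open>xb\<close>.
\<close>

lemma X_bar_minus_X_tilde:
  assumes "t \<ge> 1"
  shows "X_bar b Y t - X_tilde b X Y t = (b t / cum_weight b t) *\<^sub>R (Y t - X t)"
proof -
  have "{1..t} = insert t {1..<t}" using assms by auto
  then show ?thesis by (simp add: X_tilde_def X_bar_def algebra_simps divide_inverse)
qed

text \<open>
  The weights \<open>a\<close> of the regret and the weights \<open>b\<close> of the average may differ as long as \<open>a / b\<close> is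
  nonincreasing.  With \<open>B (x1 - x0) = b (Y - x1)\<close> for consecutive averages \<open>x0\<close> and \<open>x1\<close>, the two
  tangent inequalities at \<open>x1\<close>, towards \<open>x0\<close> and towards the minimiser, show that the new regret term
  raises the gap multiplied by \<open>a B / b\<close> from its previous to its current value; the mismatch
  between consecutive values of \<open>a / b\<close> has the favourable sign.
\<close>

lemma weighted_online_to_batch:
  fixes \<phi> :: "'v::real_inner \<Rightarrow> real"
  assumes "convex S" and Y: "\<And>s. s \<in> {1..T} \<Longrightarrow> Y s \<in> S"
    and tangent: "\<And>x y. x \<in> S \<Longrightarrow> y \<in> S \<Longrightarrow> \<phi> x + G x \<bullet> (y - x) \<le> \<phi> y"
    and xs: "xs \<in> S" and min: "\<And>x. x \<in> S \<Longrightarrow> \<phi> xs \<le> \<phi> x"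
    and a: "\<And>s. s \<ge> 1 \<Longrightarrow> a s \<ge> 0" and b: "\<And>s. s \<ge> 1 \<Longrightarrow> b s > 0"
    and mono: "\<And>s. s \<ge> 1 \<Longrightarrow> a (Suc s) / b (Suc s) \<le> a s / b s"
    and "1 \<le> t" "t \<le> T"
  shows "a t / b t * cum_weight b t * (\<phi> (X_bar b Y t) - \<phi> xs)
    \<le> (\<Sum>s=1..t. a s * (G (X_bar b Y s) \<bullet> (Y s - xs)))"
  using assms(9,10)
proof (induction t rule: dec_induct)
  case base
  have Y1: "Y 1 \<in> S" using Y[of 1] base by simp
  have b1: "b 1 > 0" using b by simp
  have "X_bar b Y 1 = Y 1" using b1 by (simp add: X_bar_def cum_weight_def)
  moreover have "\<phi> (Y 1) - \<phi> xs \<le> G (Y 1) \<bullet> (Y 1 - xs)"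
    using tangent[OF Y1 xs] by (simp add: inner_diff_right)
  ultimately show ?case
    using b1 a[of 1] by (simp add: cum_weight_def mult_left_mono)
next
  case (step t)
  define B where "B = cum_weight b t"
  define x0 x1 where "x0 = X_bar b Y t" and "x1 = X_bar b Y (Suc t)"
  define \<delta>0 \<delta>1 where "\<delta>0 = \<phi> x0 - \<phi> xs" and "\<delta>1 = \<phi> x1 - \<phi> xs"
  have pos: "B > 0" "b (Suc t) > 0" "a (Suc t) \<ge> 0"
    unfolding B_def cum_weight_def using a b step by (auto intro!: sum_pos)
  have B1: "cum_weight b (Suc t) = B + b (Suc t)" by (simp add: B_def cum_weight_def)
  have x0: "x0 \<in> S" and x1: "x1 \<in> S"
    unfolding x0_def x1_def using step by (auto intro!: X_bar_mem \<open>convex S\<close> Y b)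
  have e0: "B *\<^sub>R x0 = (\<Sum>s=1..t. b s *\<^sub>R Y s)"
    using pos by (simp add: x0_def X_bar_def B_def)
  have "(B + b (Suc t)) *\<^sub>R x1 = (\<Sum>s=1..t. b s *\<^sub>R Y s) + b (Suc t) *\<^sub>R Y (Suc t)"
    using pos by (simp add: x1_def X_bar_def B1)
  then have "b (Suc t) *\<^sub>R Y (Suc t) = B *\<^sub>R (x1 - x0) + b (Suc t) *\<^sub>R x1"
    using e0 by (simp add: algebra_simps)
  then have "b (Suc t) *\<^sub>R (Y (Suc t) - xs) = B *\<^sub>R (x1 - x0) + b (Suc t) *\<^sub>R (x1 - xs)"
    by (simp add: algebra_simps)
  then have "(1 / b (Suc t)) *\<^sub>R (b (Suc t) *\<^sub>R (Y (Suc t) - xs))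
      = (1 / b (Suc t)) *\<^sub>R (B *\<^sub>R (x1 - x0) + b (Suc t) *\<^sub>R (x1 - xs))"
    by (rule arg_cong)
  then have "Y (Suc t) - xs = (B / b (Suc t)) *\<^sub>R (x1 - x0) + (x1 - xs)"
    using pos by (simp only: scaleR_add_right scaleR_scaleR) simp
  then have "G x1 \<bullet> (Y (Suc t) - xs) = B / b (Suc t) * (G x1 \<bullet> (x1 - x0)) + G x1 \<bullet> (x1 - xs)"
    by (simp only: inner_add_right inner_scaleR_right)
  also have "\<dots> \<ge> B / b (Suc t) * (\<delta>1 - \<delta>0) + \<delta>1"
    using tangent[OF x1 x0] tangent[OF x1 xs] pos
    by (intro add_mono mult_left_mono) (auto simp: inner_diff_right \<delta>0_def \<delta>1_def)
  finally have "a (Suc t) * (B / b (Suc t) * (\<delta>1 - \<delta>0) + \<delta>1) \<le> a (Suc t) * (G x1 \<bullet> (Y (Suc t) - xs))"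
    using pos by (intro mult_left_mono) auto
  moreover have "a (Suc t) * (B / b (Suc t) * (\<delta>1 - \<delta>0) + \<delta>1)
      = a (Suc t) / b (Suc t) * (B + b (Suc t)) * \<delta>1 - a (Suc t) / b (Suc t) * (B * \<delta>0)"
    using pos by (simp add: field_simps)
  moreover have "a (Suc t) / b (Suc t) * (B * \<delta>0) \<le> a t / b t * (B * \<delta>0)"
    using mono[of t] step pos min[OF x0] by (intro mult_right_mono) (auto simp: \<delta>0_def)
  ultimately have "a (Suc t) / b (Suc t) * (B + b (Suc t)) * \<delta>1
      \<le> a t / b t * (B * \<delta>0) + a (Suc t) * (G x1 \<bullet> (Y (Suc t) - xs))"
    by linarith
  moreover have "a t / b t * (B * \<delta>0) \<le> (\<Sum>s=1..t. a s * (G (X_bar b Y s) \<bullet> (Y s - xs)))"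
    using step by (simp add: B_def \<delta>0_def x0_def mult.assoc)
  ultimately show ?case
    by (simp add: B1 \<delta>1_def x1_def)
qed

section \<open>Regret of the adaptive extragradient method\<close>

text \<open>
  One extragradient step, with the step weights absorbed into \<open>G\<close> and \<open>F\<close>.  Besides the two
  three-point inequalities, the only term to bound is \<open>(G - F) \<bullet> (y - x')\<close>.  It is split by Young's inequality
  with the weight \<open>\<Gamma>'\<close> of the following step, since
  \<open>\<Gamma>'\<^sup>2 - \<Gamma>\<^sup>2 \<le> 2 \<Gamma>' (\<Gamma>' - \<Gamma>)\<close> then makes the squared error telescope.  Using \<open>\<Gamma>'\<close> in place of \<open>\<Gamma>\<close> leaves
  excesses proportional to \<open>\<Gamma>' - \<Gamma>\<close>, which the diameter bounds by further telescoping terms.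
\<close>

lemma extragradient_potential_step:
  fixes x y x' xs G F :: "'v::real_inner"
  assumes \<gamma>: "\<gamma> > 0" and \<Gamma>: "0 < \<Gamma>" "\<Gamma> \<le> \<Gamma>'" and inc: "(norm (G - F))\<^sup>2 = \<Gamma>'\<^sup>2 - \<Gamma>\<^sup>2"
    and opt1: "0 \<le> (F + (\<Gamma> / \<gamma>) *\<^sub>R (y - x)) \<bullet> (x' - y)"
    and opt2: "0 \<le> (G + (\<Gamma> / \<gamma>) *\<^sub>R (x' - x)) \<bullet> (xs - x')"
    and D: "norm (y - x') \<le> D" "norm (x' - xs) \<le> D"
  shows "G \<bullet> (y - xs) \<le>
      ((D\<^sup>2 + \<gamma>\<^sup>2) / \<gamma> * \<Gamma>' - \<Gamma>' / (2 * \<gamma>) * (norm (x' - xs))\<^sup>2)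
    - ((D\<^sup>2 + \<gamma>\<^sup>2) / \<gamma> * \<Gamma> - \<Gamma> / (2 * \<gamma>) * (norm (x - xs))\<^sup>2)
    - \<Gamma> / (2 * \<gamma>) * (norm (x - y))\<^sup>2"
proof -
  define d d' e q m where "d = (norm (x - xs))\<^sup>2" and "d' = (norm (x' - xs))\<^sup>2"
    and "e = (norm (y - x'))\<^sup>2" and "q = (norm (x - y))\<^sup>2" and "m = (norm (x - x'))\<^sup>2"
  define k where "k = \<Gamma> / \<gamma>"
  define k' where "k' = \<Gamma>' / \<gamma>"
  have k: "0 < k" "k \<le> k'" "0 < k'"
    using \<gamma> \<Gamma> by (auto simp: k_def k'_def divide_right_mono)
  have 1: "F \<bullet> (y - x') \<le> k / 2 * (m - q - e)"
    using opt1 unfolding k_def[symmetric] m_def q_def e_def power2_norm_eq_inner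
    by (simp add: inner_add_left inner_diff_left inner_diff_right inner_commute algebra_simps)
  have 2: "G \<bullet> (x' - xs) \<le> k / 2 * (d - d' - m)"
    using opt2 unfolding k_def[symmetric] m_def d_def d'_def power2_norm_eq_inner
    by (simp add: inner_add_left inner_diff_left inner_diff_right inner_commute algebra_simps)
  have 3: "(G - F) \<bullet> (y - x') \<le> \<gamma> * (\<Gamma>' - \<Gamma>) + k' / 2 * e"
  proof -
    define n where "n = norm (G - F)"
    have "(G - F) \<bullet> (y - x') \<le> n * sqrt e"
      unfolding n_def e_def using norm_cauchy_schwarz by simp
    also have "\<dots> \<le> n\<^sup>2 / (2 * k') + k' / 2 * e"
    proof -
      have "0 \<le> (n - k' * sqrt e)\<^sup>2" by simp
      also have "\<dots> = n\<^sup>2 - 2 * k' * (n * sqrt e) + k' * k' * e"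
        by (simp add: e_def power2_eq_square algebra_simps)
      finally show ?thesis using k by (simp add: field_simps power2_eq_square)
    qed
    also have "n\<^sup>2 / (2 * k') \<le> \<gamma> * (\<Gamma>' - \<Gamma>)"
    proof -
      have "n\<^sup>2 = (\<Gamma>' - \<Gamma>) * (\<Gamma>' + \<Gamma>)"
        unfolding n_def inc by (simp add: power2_eq_square algebra_simps)
      also have "\<dots> \<le> (\<Gamma>' - \<Gamma>) * (2 * \<Gamma>')" using \<Gamma> by (intro mult_left_mono) auto
      finally have "n\<^sup>2 / (2 * k') \<le> (\<Gamma>' - \<Gamma>) * (2 * \<Gamma>') / (2 * k')"
        using k by (intro divide_right_mono) auto
      also have "\<dots> = \<gamma> * (\<Gamma>' - \<Gamma>)" using \<gamma> \<Gamma> by (simp add: k'_def)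
      finally show ?thesis .
    qed
    finally show ?thesis by simp
  qed
  \<comment> \<open>The excesses of \<open>k'\<close> over \<open>k\<close> in front of \<open>e\<close> and \<open>d'\<close> are bounded together.\<close>
  have "e \<le> D\<^sup>2" "d' \<le> D\<^sup>2" unfolding e_def d'_def using D by (auto intro!: power_mono)
  then have "(k' - k) * (e + d') \<le> (k' - k) * (D\<^sup>2 + D\<^sup>2)"
    using k by (intro mult_left_mono) auto
  then have "k' * e + k' * d' - k * e - k * d' \<le> 2 * (D\<^sup>2 * k') - 2 * (D\<^sup>2 * k)"
    by (simp add: algebra_simps)
  moreover have "G \<bullet> (y - xs) = G \<bullet> (x' - xs) + (G - F) \<bullet> (y - x') + F \<bullet> (y - x')"
    by (simp add: inner_diff_left inner_diff_right)
  ultimately have "G \<bullet> (y - xs) \<le> (D\<^sup>2 * k' + \<gamma> * \<Gamma>' - k' / 2 * d') - (D\<^sup>2 * k + \<gamma> * \<Gamma> - k / 2 * d) - k / 2 * q"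
    using 1 2 3 by (simp only: right_diff_distrib times_divide_eq_left)
  also have "D\<^sup>2 * k' + \<gamma> * \<Gamma>' = (D\<^sup>2 + \<gamma>\<^sup>2) / \<gamma> * \<Gamma>'"
    using \<gamma> by (simp add: k'_def field_simps power2_eq_square)
  also have "D\<^sup>2 * k + \<gamma> * \<Gamma> = (D\<^sup>2 + \<gamma>\<^sup>2) / \<gamma> * \<Gamma>"
    using \<gamma> by (simp add: k_def field_simps power2_eq_square)
  finally show ?thesis by (simp add: k_def k'_def d_def d'_def q_def)
qed

lemma L2_set_Un_le:
  assumes "finite A" "finite B"
  shows "L2_set f (A \<union> B) \<le> L2_set f A + L2_set f B"
proof -
  have "L2_set f (A \<union> B) \<le> sqrt ((\<Sum>i\<in>A. (f i)\<^sup>2) + (\<Sum>i\<in>B. (f i)\<^sup>2))"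
    unfolding L2_set_def using assms
    by (simp add: sum_Un sum_nonneg)
  also have "\<dots> \<le> L2_set f A + L2_set f B"
    unfolding L2_set_def by (intro sqrt_add_le_add_sqrt sum_nonneg) auto
  finally show ?thesis .
qed

text \<open>
  Let \<open>\<tau> = l D sqrt (D\<^sup>2 + \<gamma>\<^sup>2)\<close>.  Up to the last step \<open>k\<close> with \<open>\<Gamma> k \<le> \<tau>\<close> the accumulated errors cost at
  most \<open>\<tau>\<close>, and step \<open>k\<close> itself adds at most \<open>l D\<^sup>2\<close> besides its noise.  After \<open>k\<close> the remainder
  contributes at most \<open>l D s\<close>, where \<open>s\<close> is the Euclidean norm of the later distances \<open>q t\<close>, while the
  subtracted sum is at least \<open>\<tau> s\<^sup>2 / (2 \<gamma>)\<close>; completing the square removes \<open>s\<close>.  The value of \<open>\<tau>\<close> balances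
  the two costs.
\<close>

lemma adaptive_threshold:
  fixes \<delta> u q :: "nat \<Rightarrow> real"
  assumes \<Gamma>: "\<And>t. \<Gamma> t = sqrt (\<beta> + (\<Sum>s=1..<t. (\<delta> s)\<^sup>2))" and "\<beta> \<ge> 0" "\<gamma> > 0" "l \<ge> 0" "D \<ge> 0"
    and \<delta>: "\<And>t. t \<in> {1..T} \<Longrightarrow> 0 \<le> \<delta> t \<and> \<delta> t \<le> u t + l * (q t)\<^sup>2"
    and u: "\<And>t. t \<in> {1..T} \<Longrightarrow> 0 \<le> u t" 
    and q: "\<And>t. t \<in> {1..T} \<Longrightarrow> 0 \<le> q t \<and> q t \<le> D"
  shows "(D\<^sup>2 + \<gamma>\<^sup>2) / \<gamma> * \<Gamma> (Suc T) - (\<Sum>t=1..T. \<Gamma> t / (2 * \<gamma>) * (q t)\<^sup>2)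
    \<le> (D\<^sup>2 + \<gamma>\<^sup>2) / \<gamma> * (sqrt \<beta> + L2_set u {1..T}) + 5 / 2 * l * D * sqrt (D\<^sup>2 + \<gamma>\<^sup>2) ^ 3 / \<gamma>"
proof -
  define r A \<tau> where "r = sqrt (D\<^sup>2 + \<gamma>\<^sup>2)" and "A = (D\<^sup>2 + \<gamma>\<^sup>2) / \<gamma>" and "\<tau> = l * D * r"
  have r: "r > 0" "r\<^sup>2 = D\<^sup>2 + \<gamma>\<^sup>2" "D \<le> r"
    using \<open>\<gamma> > 0\<close> by (auto simp: r_def add_nonneg_pos real_le_rsqrt)
  have A: "A = r\<^sup>2 / \<gamma>" "A > 0" using r \<open>\<gamma> > 0\<close> by (auto simp: A_def add_nonneg_pos)
  have \<tau>0: "\<tau> \<ge> 0" using assms r by (simp add: \<tau>_def)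
  have \<Gamma>0: "\<Gamma> t \<ge> 0" for t unfolding \<Gamma> using \<open>\<beta> \<ge> 0\<close> by (simp add: sum_nonneg)
  have \<Gamma>mono: "\<Gamma> s \<le> \<Gamma> t" if "s \<le> t" for s t
    unfolding \<Gamma> using that by (auto intro!: sum_mono2)
  \<comment> \<open>Here \<open>k = 0\<close> encodes that \<open>\<Gamma>\<close> exceeds the threshold from the first step on.\<close>
  define k where "k = Max (insert 0 {t\<in>{1..T}. \<Gamma> t \<le> \<tau>})"
  have k: "k \<in> insert 0 {t\<in>{1..T}. \<Gamma> t \<le> \<tau>}" unfolding k_def by (rule Max_in) auto
  have above: "\<tau> < \<Gamma> t" if "t \<in> {Suc k..T}" for t
  proof (rule ccontr)
    assume "\<not> \<tau> < \<Gamma> t"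
    then have "t \<le> k" unfolding k_def using that by (intro Max_ge) auto
    then show False using that by simp
  qed
  define s where "s = L2_set q {Suc k..T}"
  have \<delta>L2: "L2_set \<delta> I \<le> L2_set u {1..T} + l * L2_set (\<lambda>t. (q t)\<^sup>2) I" if "I \<subseteq> {1..T}" for I
  proof -
    have "L2_set \<delta> I \<le> L2_set (\<lambda>t. u t + l * (q t)\<^sup>2) I"
      using \<delta> that by (intro L2_set_mono) auto
    also have "\<dots> \<le> L2_set u I + L2_set (\<lambda>t. l * (q t)\<^sup>2) I" by (rule L2_set_triangle_ineq)
    also have "L2_set (\<lambda>t. l * (q t)\<^sup>2) I = l * L2_set (\<lambda>t. (q t)\<^sup>2) I"
      using \<open>l \<ge> 0\<close> by (simp add: L2_set_right_distrib)
    also have "L2_set u I \<le> L2_set u {1..T}"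
      unfolding L2_set_def using that by (auto intro!: sum_mono2)
    finally show ?thesis by simp
  qed
  have q2: "L2_set (\<lambda>t. (q t)\<^sup>2) {Suc k..T} \<le> D * s"
  proof -
    have "L2_set (\<lambda>t. (q t)\<^sup>2) {Suc k..T} \<le> L2_set (\<lambda>t. D * q t) {Suc k..T}"
      using q by (intro L2_set_mono) (auto simp: power2_eq_square intro!: mult_right_mono)
    then show ?thesis using \<open>D \<ge> 0\<close> by (simp add: L2_set_right_distrib s_def)
  qed
  have "\<Gamma> (Suc T) \<le> sqrt \<beta> + \<tau> + L2_set u {1..T} + l * (D\<^sup>2 + D * s)"
  proof (cases "k = 0")
    case True
    have "\<Gamma> (Suc T) \<le> sqrt \<beta> + L2_set \<delta> {1..T}"
      unfolding \<Gamma> L2_set_def using \<open>\<beta> \<ge> 0\<close>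
      by (auto simp: atLeastLessThanSuc_atLeastAtMost intro!: sqrt_add_le_add_sqrt sum_nonneg)
    moreover have "L2_set \<delta> {1..T} \<le> L2_set u {1..T} + l * L2_set (\<lambda>t. (q t)\<^sup>2) {1..T}"
      by (rule \<delta>L2) simp
    moreover have "l * L2_set (\<lambda>t. (q t)\<^sup>2) {1..T} \<le> l * (D * s)"
      using q2 \<open>l \<ge> 0\<close> unfolding True by (intro mult_left_mono) simp_all
    moreover have "0 \<le> l * D\<^sup>2" using \<open>l \<ge> 0\<close> by simp
    ultimately show ?thesis using \<tau>0 by (simp add: distrib_left)
  next
    case False
    with k have k1: "1 \<le> k" "k \<le> T" "\<Gamma> k \<le> \<tau>" by auto
    have "{1..<Suc T} = {1..<k} \<union> {k..T}" using k1 by auto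
    then have "(\<Sum>s=1..<Suc T. (\<delta> s)\<^sup>2) = (\<Sum>s=1..<k. (\<delta> s)\<^sup>2) + (\<Sum>s=k..T. (\<delta> s)\<^sup>2)"
      by (simp only:) (rule sum.union_disjoint, auto)
    then have "\<Gamma> (Suc T) = sqrt ((\<beta> + (\<Sum>s=1..<k. (\<delta> s)\<^sup>2)) + (\<Sum>s=k..T. (\<delta> s)\<^sup>2))"
      unfolding \<Gamma> by (simp add: add.assoc)
    also have "\<dots> \<le> \<Gamma> k + L2_set \<delta> {k..T}"
      unfolding \<Gamma> L2_set_def using \<open>\<beta> \<ge> 0\<close> by (intro sqrt_add_le_add_sqrt add_nonneg_nonneg sum_nonneg) auto
    also have "L2_set \<delta> {k..T} \<le> L2_set u {1..T} + l * L2_set (\<lambda>t. (q t)\<^sup>2) {k..T}"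
      using k1 by (intro \<delta>L2) auto
    also have "L2_set (\<lambda>t. (q t)\<^sup>2) {k..T} \<le> D\<^sup>2 + D * s"
    proof -
      have "{k..T} = {k} \<union> {Suc k..T}" using k1 by auto
      then have "L2_set (\<lambda>t. (q t)\<^sup>2) {k..T} \<le> L2_set (\<lambda>t. (q t)\<^sup>2) {k} + L2_set (\<lambda>t. (q t)\<^sup>2) {Suc k..T}"
        by (simp only:) (rule L2_set_Un_le, auto)
      also have "L2_set (\<lambda>t. (q t)\<^sup>2) {k} \<le> D\<^sup>2"
      proof -
        have single: "L2_set f {k} = \<bar>f k\<bar>" for f :: "nat \<Rightarrow> real" by (simp add: L2_set_def)
        show ?thesis unfolding single using q[of k] k1 by (simp add: power_mono)
      qed
      finally show ?thesis using q2 by simp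
    qed
    finally have "\<Gamma> (Suc T) \<le> \<Gamma> k + (L2_set u {1..T} + l * (D\<^sup>2 + D * s))"
      using \<open>l \<ge> 0\<close> by (simp add: mult_left_mono)
    with k1(3) real_sqrt_ge_zero[OF \<open>\<beta> \<ge> 0\<close>] show ?thesis by linarith
  qed
  then have "A * \<Gamma> (Suc T) \<le> A * (sqrt \<beta> + \<tau> + L2_set u {1..T} + l * (D\<^sup>2 + D * s))"
    using A(2) by (intro mult_left_mono) auto
  then have 1: "A * \<Gamma> (Suc T) \<le> A * (sqrt \<beta> + L2_set u {1..T}) + A * \<tau> + A * l * D\<^sup>2 + A * l * D * s"
    by (simp only: distrib_left mult.assoc add.assoc)
  have 2: "\<tau> / (2 * \<gamma>) * s\<^sup>2 \<le> (\<Sum>t=1..T. \<Gamma> t / (2 * \<gamma>) * (q t)\<^sup>2)"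
  proof -
    have "\<tau> / (2 * \<gamma>) * s\<^sup>2 = (\<Sum>t=Suc k..T. \<tau> / (2 * \<gamma>) * (q t)\<^sup>2)"
      by (simp add: s_def L2_set_def sum_nonneg sum_distrib_left)
    also have "\<dots> \<le> (\<Sum>t=Suc k..T. \<Gamma> t / (2 * \<gamma>) * (q t)\<^sup>2)"
      using above \<open>\<gamma> > 0\<close> by (intro sum_mono mult_right_mono divide_right_mono) (auto simp: less_imp_le)
    also have "\<dots> \<le> (\<Sum>t=1..T. \<Gamma> t / (2 * \<gamma>) * (q t)\<^sup>2)"
      using \<Gamma>0 \<open>\<gamma> > 0\<close> by (intro sum_mono2) auto
    finally show ?thesis .
  qed
  have 3: "A * l * D * s \<le> A * \<tau> / 2 + \<tau> / (2 * \<gamma>) * s\<^sup>2"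
  proof -
    have "2 * r * s \<le> r\<^sup>2 + s\<^sup>2" by (rule sum_squares_bound)
    then have "l * D * r / (2 * \<gamma>) * (2 * r * s) \<le> l * D * r / (2 * \<gamma>) * (r\<^sup>2 + s\<^sup>2)"
      using assms r by (intro mult_left_mono) auto
    moreover have "A * l * D * s = l * D * r / (2 * \<gamma>) * (2 * r * s)"
      by (simp add: A(1) power2_eq_square)
    moreover have "A * \<tau> / 2 + \<tau> / (2 * \<gamma>) * s\<^sup>2 = l * D * r / (2 * \<gamma>) * (r\<^sup>2 + s\<^sup>2)"
      by (simp add: A(1) \<tau>_def distrib_left add_divide_distrib mult_ac)
    ultimately show ?thesis by simp
  qed
  have 4: "A * l * D\<^sup>2 \<le> A * \<tau>"
  proof -
    have "A * (l * D) * D \<le> A * (l * D) * r"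
      using A(2) r(3) \<open>l \<ge> 0\<close> \<open>D \<ge> 0\<close> by (intro mult_left_mono) auto
    then show ?thesis by (simp add: \<tau>_def power2_eq_square mult_ac)
  qed
  have 5: "A * \<tau> = l * D * r ^ 3 / \<gamma>"
    by (simp add: A(1) \<tau>_def power2_eq_square power3_eq_cube)
  have "A * \<Gamma> (Suc T) - (\<Sum>t=1..T. \<Gamma> t / (2 * \<gamma>) * (q t)\<^sup>2)
      \<le> A * (sqrt \<beta> + L2_set u {1..T}) + 5 / 2 * (A * \<tau>)"
    using 1 2 3 4 by linarith
  then show ?thesis
    unfolding 5 by (simp add: A_def r_def)
qed

section \<open>Extra-Newton along a fixed realisation\<close>

lemma extra_newton_iterates_mem:
  assumes "extra_newton_run S g H a b \<gamma> \<beta>0 T x1 z X Y" "x1 \<in> S"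
  shows "t \<in> {1..T + 1} \<Longrightarrow> X t \<in> S" "t \<in> {1..T} \<Longrightarrow> Y t \<in> S"
proof -
  show "Y t \<in> S" if "t \<in> {1..T}" for t
    using assms(1) that unfolding extra_newton_run_def Let_def is_arg_min_def by blast
  have "X (t + 1) \<in> S" if "t \<in> {1..T}" for t
    using assms(1) that unfolding extra_newton_run_def Let_def is_arg_min_def by blast
  moreover have "X 1 \<in> S" using assms unfolding extra_newton_run_def by simp
  moreover have "t = 1 \<or> (t - 1 \<in> {1..T} \<and> t - 1 + 1 = t)" if "t \<in> {1..T + 1}" for t
    using that by auto
  ultimately show "X t \<in> S" if "t \<in> {1..T + 1}" for t
    using that by metis
qed

text \<open>
  Three noise terms and the Taylor remainder; the Hessian noise is scaled by the distance over which
  the model extrapolates.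
\<close>

lemma newton_prediction_error:
  fixes x x' :: "real^'n"
  assumes taylor: "norm (gf x - gf x' - Hf x' *v (x - x')) \<le> L / 2 * (norm (x - x'))\<^sup>2"
  shows "norm (g x s - F_tilde g H x x' s')
    \<le> norm (g x s - gf x) + norm (g x' s' - gf x') + op_norm (H x' s' - Hf x') * norm (x - x')
      + L / 2 * (norm (x - x'))\<^sup>2"
proof -
  have "g x s - F_tilde g H x x' s' = (g x s - gf x) - (g x' s' - gf x')
      - (H x' s' - Hf x') *v (x - x') + (gf x - gf x' - Hf x' *v (x - x'))"
    by (simp add: F_tilde_def matrix_vector_mult_diff_rdistrib)
  also have "norm \<dots> \<le> norm (g x s - gf x) + norm (g x' s' - gf x')
      + norm ((H x' s' - Hf x') *v (x - x')) + norm (gf x - gf x' - Hf x' *v (x - x'))"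
    by (intro norm_triangle_mono norm_triangle_le_diff add_mono order_refl)
  finally show ?thesis
    using taylor norm_matrix_vector_le[of "H x' s' - Hf x'" "x - x'"] by linarith
qed

text \<open>
  The whole analysis for a fixed realisation.  All randomness is isolated in the noise magnitudes
  \<open>n1\<close>, \<open>n2\<close> (gradient at the new average and at the prediction point), \<open>nH\<close> (Hessian), and in the
  linear term that replaces the stochastic gradient by the true one.
\<close>

lemma extra_newton_pathwise_bound:
  fixes S :: "(real^'n) set" and \<phi> :: "real^'n \<Rightarrow> real" and a b :: "nat \<Rightarrow> real" and p :: real
    and X Y :: "nat \<Rightarrow> real^'n"
  assumes S: "convex S" "bounded S"
    and tangent: "\<And>x y. x \<in> S \<Longrightarrow> y \<in> S \<Longrightarrow> \<phi> x + gf x \<bullet> (y - x) \<le> \<phi> y"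
    and taylor: "\<And>x y. x \<in> S \<Longrightarrow> y \<in> S \<Longrightarrow>
      norm (gf y - gf x - Hf x *v (y - x)) \<le> L / 2 * (norm (y - x))\<^sup>2"
    and xs: "xs \<in> S" "\<And>x. x \<in> S \<Longrightarrow> \<phi> xs \<le> \<phi> x"
    and sym: "\<And>x k. x \<in> S \<Longrightarrow> 2 \<le> k \<Longrightarrow> transpose (H x (z k)) = H x (z k)"
    and "L \<ge> 0" "p \<ge> 2" and a: "\<And>t. a t = real t ^ 2" and b: "\<And>t. b t = real t powr p"
    and "\<gamma> > 0" "\<beta>0 > 0" "T \<ge> 1" "x1 \<in> S"
    and run: "extra_newton_run S g H a b \<gamma> \<beta>0 T x1 z X Y"
  defines "D \<equiv> diameter S"
  defines "xb \<equiv> X_bar b Y" and "xt \<equiv> X_tilde b X Y"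
  defines "n1 \<equiv> \<lambda>t. norm (g (xb t) (z (2 * t + 1)) - gf (xb t))"
    and "n2 \<equiv> \<lambda>t. norm (g (xt t) (z (2 * t)) - gf (xt t))"
    and "nH \<equiv> \<lambda>t. op_norm (H (xt t) (z (2 * t)) - Hf (xt t))"
  shows "real T ^ 3 / (p + 1) * (\<phi> (xb T) - \<phi> xs)
    \<le> (\<Sum>t=1..T. a t * ((gf (xb t) - g (xb t) (z (2 * t + 1))) \<bullet> (Y t - xs)))
      + (D\<^sup>2 + \<gamma>\<^sup>2) / \<gamma> * (sqrt \<beta>0 + L2_set (\<lambda>t. a t * (n1 t + n2 t)) {1..T}
          + (p + 1) * D * L2_set (\<lambda>t. real t * nH t) {1..T})
      + 5 / 2 * (L / 2 * (p + 1)\<^sup>2) * D * sqrt (D\<^sup>2 + \<gamma>\<^sup>2) ^ 3 / \<gamma>"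
proof -
  define A where "A = (D\<^sup>2 + \<gamma>\<^sup>2) / \<gamma>"
  define B where "B = cum_weight b"
  define G where "G t = g (xb t) (z (2 * t + 1))" for t
  define F where "F t = F_tilde g H (xb t) (xt t) (z (2 * t))" for t
  define \<delta> where "\<delta> t = a t * norm (G t - F t)" for t
  define \<Gamma> where "\<Gamma> t = sqrt (\<beta>0 + (\<Sum>s=1..<t. (\<delta> s)\<^sup>2))" for t
  define q where "q t = norm (X t - Y t)" for t
  define \<Phi> where "\<Phi> t = A * \<Gamma> t - \<Gamma> t / (2 * \<gamma>) * (norm (X t - xs))\<^sup>2" for t
  have D0: "D \<ge> 0" unfolding D_def by (rule diameter_ge_0) fact
  have dist: "norm (x - y) \<le> D" if "x \<in> S" "y \<in> S" for x y
    unfolding D_def using diameter_bounded_bound[OF \<open>bounded S\<close> that] by (simp add: dist_norm)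
  have A0: "A \<ge> 0" using \<open>\<gamma> > 0\<close> by (simp add: A_def)
  have apos: "a t > 0" and bpos: "b t > 0" if "t \<ge> 1" for t using that by (auto simp: a b)
  have Bpos: "B t > 0" if "t \<ge> 1" for t
    unfolding B_def cum_weight_def using that bpos by (intro sum_pos) auto
  have bfun: "b = (\<lambda>s. real s powr p)" using b by auto
  have X: "X t \<in> S" if "t \<in> {1..T + 1}" for t
    using extra_newton_iterates_mem(1)[OF run \<open>x1 \<in> S\<close> that] .
  have Y: "Y t \<in> S" if "t \<in> {1..T}" for t
    using extra_newton_iterates_mem(2)[OF run \<open>x1 \<in> S\<close> that] .
  have xb: "xb t \<in> S" if "t \<in> {1..T}" for t
    unfolding xb_def using that by (intro X_bar_mem S Y bpos) auto
  have xt: "xt t \<in> S" if "t \<in> {1..T}" for t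
    unfolding xt_def using that by (intro X_tilde_mem S X Y bpos) auto
  have \<Gamma>pos: "\<Gamma> t > 0" for t
    unfolding \<Gamma>_def using \<open>\<beta>0 > 0\<close> by (simp add: add_pos_nonneg sum_nonneg)
  have \<Gamma>sq: "(\<Gamma> t)\<^sup>2 = \<beta>0 + (\<Sum>s=1..<t. (\<delta> s)\<^sup>2)" for t
    unfolding \<Gamma>_def using \<open>\<beta>0 > 0\<close> by (simp add: sum_nonneg)
  have step: "step_size g H a b \<gamma> \<beta>0 z X Y t = \<gamma> / \<Gamma> t" for t
    by (simp add: step_size_def \<Gamma>_def \<delta>_def G_def F_def xb_def xt_def power_mult_distrib)
  have diff: "xb t - xt t = (b t / B t) *\<^sub>R (Y t - X t)" if "t \<ge> 1" for t
    unfolding xb_def xt_def B_def by (rule X_bar_minus_X_tilde[OF that])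

  have increment: "a t * (G t \<bullet> (Y t - xs)) \<le> \<Phi> (Suc t) - \<Phi> t - \<Gamma> t / (2 * \<gamma>) * (q t)\<^sup>2"
    if t: "t \<in> {1..T}" for t
  proof -
    have t1: "t \<ge> 1" using t by simp
    have Xt: "X t \<in> S" "X (Suc t) \<in> S" "Y t \<in> S" using t X[of t] X[of "Suc t"] Y by auto
    have min1: "is_arg_min
          (\<lambda>x. (a t *\<^sub>R g (xt t) (z (2 * t))) \<bullet> x
             + (a t * b t / B t) / 2 * ((H (xt t) (z (2 * t)) *v (x - X t)) \<bullet> (x - X t))
             + 1 / (2 * (\<gamma> / \<Gamma> t)) * (norm (x - X t))\<^sup>2) (\<lambda>x. x \<in> S) (Y t)"
      using run t unfolding extra_newton_run_def Let_def step B_def xt_def by (simp add: mult.commute)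
    have "0 \<le> (a t *\<^sub>R g (xt t) (z (2 * t)) + (a t * b t / B t) *\<^sub>R (H (xt t) (z (2 * t)) *v (Y t - X t))
        + (1 / (\<gamma> / \<Gamma> t)) *\<^sub>R (Y t - X t)) \<bullet> (X (Suc t) - Y t)"
      using t1 by (intro arg_min_quadratic_first_order[OF S(1) _ min1 Xt(2)] sym xt t) auto
    also have "a t *\<^sub>R g (xt t) (z (2 * t)) + (a t * b t / B t) *\<^sub>R (H (xt t) (z (2 * t)) *v (Y t - X t))
        = a t *\<^sub>R F t"
      by (simp add: F_def F_tilde_def diff[OF t1] matrix_vector_mult_scaleR scaleR_add_right)
    finally have opt1: "0 \<le> (a t *\<^sub>R F t + (\<Gamma> t / \<gamma>) *\<^sub>R (Y t - X t)) \<bullet> (X (Suc t) - Y t)"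
      by simp
    \<comment> \<open>The second subproblem is the case of a vanishing quadratic form.\<close>
    have min2: "is_arg_min
          (\<lambda>x. (a t *\<^sub>R G t) \<bullet> x + 0 / 2 * ((mat 1 *v (x - X t)) \<bullet> (x - X t))
             + 1 / (2 * (\<gamma> / \<Gamma> t)) * (norm (x - X t))\<^sup>2) (\<lambda>x. x \<in> S) (X (Suc t))"
      using run t unfolding extra_newton_run_def Let_def step G_def xb_def by simp
    have opt2: "0 \<le> (a t *\<^sub>R G t + (\<Gamma> t / \<gamma>) *\<^sub>R (X (Suc t) - X t)) \<bullet> (xs - X (Suc t))"
      using arg_min_quadratic_first_order[OF S(1) transpose_mat min2 xs(1)] by simp
    have "(norm (a t *\<^sub>R G t - a t *\<^sub>R F t))\<^sup>2 = (\<delta> t)\<^sup>2"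
      by (simp add: \<delta>_def scaleR_diff_right[symmetric] power_mult_distrib)
    also have "\<dots> = (\<Gamma> (Suc t))\<^sup>2 - (\<Gamma> t)\<^sup>2"
      using t1 by (simp add: \<Gamma>sq)
    finally have inc: "(norm (a t *\<^sub>R G t - a t *\<^sub>R F t))\<^sup>2 = (\<Gamma> (Suc t))\<^sup>2 - (\<Gamma> t)\<^sup>2" .
    have mono: "\<Gamma> t \<le> \<Gamma> (Suc t)"
      unfolding \<Gamma>_def by (auto intro!: sum_mono2)
    show ?thesis
      using extragradient_potential_step[OF \<open>\<gamma> > 0\<close> \<Gamma>pos mono inc opt1 opt2
          dist[OF Xt(3,2)] dist[OF Xt(2) xs(1)]]
      by (simp add: \<Phi>_def A_def q_def)
  qed

  have regret: "(\<Sum>t=1..T. a t * (G t \<bullet> (Y t - xs)))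
      \<le> A * \<Gamma> (Suc T) - (\<Sum>t=1..T. \<Gamma> t / (2 * \<gamma>) * (q t)\<^sup>2)"
  proof -
    have "(\<Sum>t=1..T. a t * (G t \<bullet> (Y t - xs)))
        \<le> (\<Sum>t=1..T. \<Phi> (Suc t) - \<Phi> t - \<Gamma> t / (2 * \<gamma>) * (q t)\<^sup>2)"
      by (intro sum_mono increment)
    also have "\<dots> = \<Phi> (Suc T) - \<Phi> 1 - (\<Sum>t=1..T. \<Gamma> t / (2 * \<gamma>) * (q t)\<^sup>2)"
      unfolding sum_subtractf[of "\<lambda>t. \<Phi> (Suc t) - \<Phi> t"] by (subst sum_Suc_diff) auto
    finally have "(\<Sum>t=1..T. a t * (G t \<bullet> (Y t - xs)))
        \<le> \<Phi> (Suc T) - \<Phi> 1 - (\<Sum>t=1..T. \<Gamma> t / (2 * \<gamma>) * (q t)\<^sup>2)" .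
    moreover have "\<Phi> (Suc T) \<le> A * \<Gamma> (Suc T)"
      unfolding \<Phi>_def using \<open>\<gamma> > 0\<close> \<Gamma>pos[of "Suc T"] by simp
    moreover have "\<Phi> 1 \<ge> 0"
    proof -
      have "(norm (X 1 - xs))\<^sup>2 \<le> D\<^sup>2"
        using dist[OF X[of 1] xs(1)] \<open>T \<ge> 1\<close> by (intro power_mono) auto
      then have "\<Gamma> 1 / (2 * \<gamma>) * (norm (X 1 - xs))\<^sup>2 \<le> \<Gamma> 1 / (2 * \<gamma>) * (2 * (D\<^sup>2 + \<gamma>\<^sup>2))"
        using \<Gamma>pos[of 1] \<open>\<gamma> > 0\<close> by (intro mult_left_mono) (auto simp: add_increasing2 order_trans)
      also have "\<dots> = A * \<Gamma> 1" using \<open>\<gamma> > 0\<close> by (simp add: A_def field_simps)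
      finally show ?thesis by (simp add: \<Phi>_def)
    qed
    ultimately show ?thesis by simp
  qed

  define u where "u t = a t * (n1 t + n2 t) + (p + 1) * D * (real t * nH t)" for t
  have \<delta>_le: "0 \<le> \<delta> t \<and> \<delta> t \<le> u t + (L / 2 * (p + 1)\<^sup>2) * (q t)\<^sup>2" if t: "t \<in> {1..T}" for t
  proof -
    have t1: "t \<ge> 1" using t by simp
    define e where "e = norm (xb t - xt t)"
    have "e = b t / B t * q t"
      unfolding e_def diff[OF t1] q_def using bpos[OF t1] Bpos[OF t1] by (simp add: norm_minus_commute)
    also have "\<dots> \<le> (p + 1) / real t * q t"
      using weight_ratio_le[of p t] \<open>p \<ge> 2\<close> t1
      by (intro mult_right_mono) (auto simp: B_def b bfun q_def)
    finally have te: "real t * e \<le> (p + 1) * q t" using t1 by (simp add: field_simps)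
    have e0: "e \<ge> 0" "q t \<ge> 0" by (auto simp: e_def q_def)
    have qD: "q t \<le> D" unfolding q_def using t by (intro dist X Y) auto
    have "norm (G t - F t) \<le> n1 t + n2 t + nH t * e + L / 2 * e\<^sup>2"
      unfolding G_def F_def n1_def n2_def nH_def e_def
      by (rule newton_prediction_error[where g = g and H = H and gf = gf and Hf = Hf
            and x = "xb t" and x' = "xt t"]) (rule taylor[OF xt[OF t] xb[OF t]])
    then have "\<delta> t \<le> a t * (n1 t + n2 t + nH t * e + L / 2 * e\<^sup>2)"
      unfolding \<delta>_def using apos[OF t1] by (intro mult_left_mono) auto
    also have "\<dots> = a t * (n1 t + n2 t) + (real t * nH t) * (real t * e) + L / 2 * (real t * e)\<^sup>2"
      by (simp add: a power2_eq_square algebra_simps)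
    also have "\<dots> \<le> a t * (n1 t + n2 t) + (real t * nH t) * ((p + 1) * D) + L / 2 * ((p + 1) * q t)\<^sup>2"
    proof (intro add_mono order_refl mult_left_mono power_mono te)
      show "real t * e \<le> (p + 1) * D"
        by (rule order_trans[OF te mult_left_mono[OF qD]]) (use \<open>p \<ge> 2\<close> in simp)
      show "0 \<le> real t * nH t" by (simp add: nH_def op_norm_nonneg)
      show "0 \<le> L / 2" using \<open>L \<ge> 0\<close> by simp
      show "0 \<le> real t * e" using e0 by simp
    qed
    also have "\<dots> = u t + (L / 2 * (p + 1)\<^sup>2) * (q t)\<^sup>2"
      by (simp add: u_def power_mult_distrib mult_ac)
    finally show ?thesis using apos[OF t1] by (simp add: \<delta>_def)
  qed
  have u0: "0 \<le> u t" if "t \<in> {1..T}" for t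
    using apos[of t] that D0 \<open>p \<ge> 2\<close> by (simp add: u_def n1_def n2_def nH_def op_norm_nonneg)
  have q: "0 \<le> q t \<and> q t \<le> D" if "t \<in> {1..T}" for t
    unfolding q_def using that by (auto intro!: dist X Y)
  have l0: "0 \<le> L / 2 * (p + 1)\<^sup>2" using \<open>L \<ge> 0\<close> by simp
  have "L2_set u {1..T} \<le> L2_set (\<lambda>t. a t * (n1 t + n2 t)) {1..T}
      + L2_set (\<lambda>t. (p + 1) * D * (real t * nH t)) {1..T}"
    unfolding u_def by (rule L2_set_triangle_ineq)
  also have "L2_set (\<lambda>t. (p + 1) * D * (real t * nH t)) {1..T} = (p + 1) * D * L2_set (\<lambda>t. real t * nH t) {1..T}"
    using D0 \<open>p \<ge> 2\<close> by (intro L2_set_right_distrib[symmetric]) simp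
  finally have uL2: "A * (sqrt \<beta>0 + L2_set u {1..T}) \<le> A * (sqrt \<beta>0 + L2_set (\<lambda>t. a t * (n1 t + n2 t)) {1..T}
      + (p + 1) * D * L2_set (\<lambda>t. real t * nH t) {1..T})"
    using A0 by (intro mult_left_mono) auto
  have "A * \<Gamma> (Suc T) - (\<Sum>t=1..T. \<Gamma> t / (2 * \<gamma>) * (q t)\<^sup>2) \<le> A * (sqrt \<beta>0 + L2_set u {1..T})
      + 5 / 2 * (L / 2 * (p + 1)\<^sup>2) * D * sqrt (D\<^sup>2 + \<gamma>\<^sup>2) ^ 3 / \<gamma>"
    unfolding A_def
    by (rule adaptive_threshold[where T = T, OF \<Gamma>_def less_imp_le[OF \<open>\<beta>0 > 0\<close>] \<open>\<gamma> > 0\<close> l0 D0 \<delta>_le u0 q])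
  with regret have "(\<Sum>t=1..T. a t * (G t \<bullet> (Y t - xs))) \<le> A * (sqrt \<beta>0 + L2_set u {1..T})
      + 5 / 2 * (L / 2 * (p + 1)\<^sup>2) * D * sqrt (D\<^sup>2 + \<gamma>\<^sup>2) ^ 3 / \<gamma>"
    by linarith
  note noisy = order_trans[OF this add_right_mono[OF uL2]]

  have "real T ^ 3 / (p + 1) * (\<phi> (xb T) - \<phi> xs) \<le> a T / b T * B T * (\<phi> (xb T) - \<phi> xs)"
  proof (intro mult_right_mono)
    have "real T powr p * real T \<le> (p + 1) * B T"
      using powr_le_cum_weight[of p T] \<open>p \<ge> 2\<close> \<open>T \<ge> 1\<close> by (simp add: powr_add B_def bfun)
    then have "real T ^ 2 * (real T powr p * real T) \<le> real T ^ 2 * ((p + 1) * B T)"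
      by (rule mult_left_mono) simp
    then show "real T ^ 3 / (p + 1) \<le> a T / b T * B T"
      using \<open>p \<ge> 2\<close> \<open>T \<ge> 1\<close> by (simp add: a b field_simps power2_eq_square power3_eq_cube)
    show "0 \<le> \<phi> (xb T) - \<phi> xs" using xs xb \<open>T \<ge> 1\<close> by simp
  qed
  also have "\<dots> \<le> (\<Sum>t=1..T. a t * (gf (xb t) \<bullet> (Y t - xs)))"
    unfolding B_def xb_def
  proof (rule weighted_online_to_batch[where S = S and T = T])
    show "a (Suc s) / b (Suc s) \<le> a s / b s" if "s \<ge> 1" for s
    proof -
      have "a s / b s = real s powr (2 - p)" if "s \<ge> 1" for s
        using that by (simp add: a b powr_diff)
      then show ?thesis using that \<open>p \<ge> 2\<close> powr_mono2'[of "2 - p" "real s" "real (Suc s)"] by simp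
    qed
    show "a s \<ge> 0" if "s \<ge> 1" for s using apos[OF that] by simp
  qed (use S tangent xs Y bpos \<open>T \<ge> 1\<close> in auto)
  also have "\<dots> = (\<Sum>t=1..T. a t * ((gf (xb t) - G t) \<bullet> (Y t - xs))) + (\<Sum>t=1..T. a t * (G t \<bullet> (Y t - xs)))"
    by (simp add: sum.distrib[symmetric] inner_diff_left algebra_simps)
  finally show ?thesis
    using noisy unfolding A_def G_def by simp
qed

section \<open>Measurability and moments\<close>

text \<open>
  A convex function on a finite-dimensional space is continuous, so this yields the measurability of the
  operator norm.
\<close>

lemma convex_on_op_norm: "convex_on UNIV (op_norm :: real^'n^'n \<Rightarrow> real)"
proof (rule convex_onI)
  fix t :: real and A B :: "real^'n^'n"
  assume t: "0 < t" "t < 1"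
  have "op_norm ((1 - t) *\<^sub>R A + t *\<^sub>R B) = onorm (\<lambda>v. (1 - t) *\<^sub>R (A *v v) + t *\<^sub>R (B *v v))"
    unfolding op_norm_def
    by (intro arg_cong[where f = onorm] ext)
      (simp add: matrix_vector_mult_add_rdistrib scaleR_matrix_vector_assoc)
  also have "\<dots> \<le> onorm (\<lambda>v. (1 - t) *\<^sub>R (A *v v)) + onorm (\<lambda>v. t *\<^sub>R (B *v v))"
    by (intro onorm_triangle bounded_linear_scaleR_right[THEN bounded_linear_compose]
        matrix_vector_mul_bounded_linear)
  also have "\<dots> = (1 - t) * op_norm A + t * op_norm B"
    using t by (simp add: op_norm_def onorm_scaleR matrix_vector_mul_bounded_linear)
  finally show "op_norm ((1 - t) *\<^sub>R A + t *\<^sub>R B) \<le> (1 - t) * op_norm A + t * op_norm B" .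
qed simp

lemma borel_measurable_op_norm [measurable]: "op_norm \<in> borel_measurable borel"
  by (intro borel_measurable_continuous_onI convex_on_continuous open_UNIV convex_on_op_norm)

lemma borel_measurable_matrix_vector_mult [measurable (raw)]:
  fixes A :: "'w \<Rightarrow> real^'n^'m" and v :: "'w \<Rightarrow> real^'n"
  assumes "A \<in> borel_measurable N" "v \<in> borel_measurable N"
  shows "(\<lambda>\<omega>. A \<omega> *v v \<omega>) \<in> borel_measurable N"
proof (rule borel_measurable_continuous_Pair[OF assms])
  show "continuous_on UNIV (\<lambda>x. (fst x :: real^'n^'m) *v (snd x :: real^'n))"
    unfolding matrix_vector_mult_def by (intro continuous_intros)
qed

lemma borel_measurable_oracle_query:
  assumes "(\<lambda>(x, s). g x s) \<in> borel_measurable (restrict_space borel S \<Otimes>\<^sub>M P)"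
    and "U \<in> borel_measurable N" "\<And>\<omega>. \<omega> \<in> space N \<Longrightarrow> U \<omega> \<in> S" "Z \<in> measurable N P"
  shows "(\<lambda>\<omega>. g (U \<omega>) (Z \<omega>)) \<in> borel_measurable N"
proof -
  have "(\<lambda>\<omega>. (U \<omega>, Z \<omega>)) \<in> measurable N (restrict_space borel S \<Otimes>\<^sub>M P)"
    using assms by (intro measurable_Pair measurable_restrict_space2) auto
  from measurable_compose[OF this assms(1)] show ?thesis by simp
qed

text \<open>
  Gradient and Hessian on \<open>S\<close> inherit their measurability from the stochastic queries as parameter
  integrals.
\<close>

lemma borel_measurable_oracle_mean:
  fixes G :: "'v::euclidean_space \<Rightarrow> 's \<Rightarrow> 'b::euclidean_space"
  assumes "prob_space P" and "(\<lambda>(x, s). G x s) \<in> borel_measurable (restrict_space borel S \<Otimes>\<^sub>M P)"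
    and "\<And>x. x \<in> S \<Longrightarrow> (\<integral>s. G x s \<partial>P) = m x"
  shows "m \<in> borel_measurable (restrict_space borel S)"
proof -
  interpret prob_space P by fact
  have "(\<lambda>x. \<integral>s. G x s \<partial>P) \<in> borel_measurable (restrict_space borel S)"
    by (rule borel_measurable_lebesgue_integral) (rule assms(2))
  then show ?thesis
    by (rule measurable_cong[THEN iffD1, rotated]) (simp add: assms(3) space_restrict_space)
qed

lemma (in prob_space) expectation_sqrt_le:
  assumes "integrable M Z" "\<And>\<omega>. \<omega> \<in> space M \<Longrightarrow> 0 \<le> Z \<omega>"
  shows "integrable M (\<lambda>\<omega>. sqrt (Z \<omega>))" "expectation (\<lambda>\<omega>. sqrt (Z \<omega>)) \<le> sqrt (expectation Z)"
proof -
  have meas: "(\<lambda>\<omega>. sqrt (Z \<omega>)) \<in> borel_measurable M" using assms(1) by simp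
  show int: "integrable M (\<lambda>\<omega>. sqrt (Z \<omega>))"
  proof (rule Bochner_Integration.integrable_bound[of _ "\<lambda>\<omega>. 1 + Z \<omega>"])
    show "AE \<omega> in M. norm (sqrt (Z \<omega>)) \<le> norm (1 + Z \<omega>)"
    proof (rule AE_I2)
      fix \<omega> assume "\<omega> \<in> space M"
      then have "0 \<le> Z \<omega>" by (rule assms)
      then have "Z \<omega> \<le> (1 + Z \<omega>)\<^sup>2" by (simp add: power2_eq_square algebra_simps)
      then show "norm (sqrt (Z \<omega>)) \<le> norm (1 + Z \<omega>)" using \<open>0 \<le> Z \<omega>\<close> by (simp add: real_le_lsqrt)
    qed
  qed (use assms meas in auto)
  have sq_int: "integrable M (\<lambda>\<omega>. (sqrt (Z \<omega>))\<^sup>2) \<longleftrightarrow> integrable M Z"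
    by (intro Bochner_Integration.integrable_cong) (simp_all add: assms(2))
  have sq: "expectation (\<lambda>\<omega>. (sqrt (Z \<omega>))\<^sup>2) = expectation Z"
    by (intro Bochner_Integration.integral_cong) (simp_all add: assms(2))
  have "0 \<le> variance (\<lambda>\<omega>. sqrt (Z \<omega>))" by (rule variance_positive)
  also have "\<dots> = expectation Z - (expectation (\<lambda>\<omega>. sqrt (Z \<omega>)))\<^sup>2"
    using variance_eq[OF int] sq_int sq assms(1) by simp
  finally show "expectation (\<lambda>\<omega>. sqrt (Z \<omega>)) \<le> sqrt (expectation Z)"
    by (intro real_le_rsqrt) simp
qed

text \<open>
  Jensen's inequality moves the expectation under the square root; this is why noise accumulates
  like the root of the sum of the variances.
\<close>

lemma (in prob_space) expectation_L2_set_le: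
  assumes "\<And>i. i \<in> I \<Longrightarrow> integrable M (\<lambda>\<omega>. (u i \<omega>)\<^sup>2)"
    and "\<And>i. i \<in> I \<Longrightarrow> expectation (\<lambda>\<omega>. (u i \<omega>)\<^sup>2) \<le> c i"
  shows "integrable M (\<lambda>\<omega>. L2_set (\<lambda>i. u i \<omega>) I)"
    "expectation (\<lambda>\<omega>. L2_set (\<lambda>i. u i \<omega>) I) \<le> sqrt (\<Sum>i\<in>I. c i)"
proof -
  have Z: "integrable M (\<lambda>\<omega>. \<Sum>i\<in>I. (u i \<omega>)\<^sup>2)" "\<And>\<omega>. 0 \<le> (\<Sum>i\<in>I. (u i \<omega>)\<^sup>2)"
    using assms by (auto intro: sum_nonneg)
  note * = expectation_sqrt_le[OF Z]
  show "integrable M (\<lambda>\<omega>. L2_set (\<lambda>i. u i \<omega>) I)" unfolding L2_set_def by (rule *(1))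
  have "expectation (\<lambda>\<omega>. \<Sum>i\<in>I. (u i \<omega>)\<^sup>2) \<le> (\<Sum>i\<in>I. c i)"
    using assms by (simp add: sum_mono)
  then show "expectation (\<lambda>\<omega>. L2_set (\<lambda>i. u i \<omega>) I) \<le> sqrt (\<Sum>i\<in>I. c i)"
    unfolding L2_set_def by (intro order_trans[OF *(2)]) simp
qed

section \<open>Queries at fresh samples\<close>

text \<open>
  Samples are numbered from 2, as in the algorithm: sample \<open>2 t\<close> is drawn in the first and sample
  \<open>2 t + 1\<close> in the second half of step \<open>t\<close>.
\<close>

locale iid_sampling = prob_space M + P: prob_space P
  for M :: "'w measure" and P :: "'s measure" +
  fixes \<xi> :: "nat \<Rightarrow> 'w \<Rightarrow> 's"
  assumes indep: "indep_vars (\<lambda>_. P) \<xi> {2..}"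
    and law: "\<And>k. k \<ge> 2 \<Longrightarrow> distr M P (\<xi> k) = P"

begin

text \<open>
  The information available before sample \<open>k\<close> is drawn.
\<close>

definition past :: "nat \<Rightarrow> 'w measure" where
  "past k = vimage_algebra (space M) (\<lambda>\<omega>. \<lambda>j\<in>{2..<k}. \<xi> j \<omega>) (\<Pi>\<^sub>M j\<in>{2..<k}. P)"

lemma space_past [simp]: "space (past k) = space M"
  by (simp add: past_def)

lemma measurable_sample: "k \<ge> 2 \<Longrightarrow> \<xi> k \<in> measurable M P"
  using indep unfolding indep_vars_def by simp

lemma sample_in_space: "k \<ge> 2 \<Longrightarrow> \<omega> \<in> space M \<Longrightarrow> \<xi> k \<omega> \<in> space P"
  using measurable_space[OF measurable_sample] .

lemma measurable_tuple_past:
  "(\<lambda>\<omega>. \<lambda>j\<in>{2..<k}. \<xi> j \<omega>) \<in> measurable (past k) (\<Pi>\<^sub>M j\<in>{2..<k}. P)"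
  unfolding past_def by (rule measurable_vimage_algebra1) (auto simp: space_PiM sample_in_space)

lemma measurable_sample_past:
  assumes "2 \<le> j" "j < k"
  shows "\<xi> j \<in> measurable (past k) P"
proof -
  have "(\<lambda>x. x j) \<in> measurable (\<Pi>\<^sub>M j\<in>{2..<k}. P) P"
    by (rule measurable_component_singleton) (use assms in simp)
  from measurable_compose[OF measurable_tuple_past this] show ?thesis using assms by simp
qed

lemma measurable_past_mono:
  assumes "j \<le> k" "U \<in> measurable (past j) N"
  shows "U \<in> measurable (past k) N"
proof -
  have "(\<lambda>\<omega>. \<omega>) \<in> measurable (past k) (past j)"
    unfolding past_def[of j]
    by (rule measurable_vimage_algebra2) (use assms in \<open>auto intro!: measurable_restrict measurable_sample_past\<close>)
  from measurable_compose[OF this assms(2)] show ?thesis by simp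
qed

lemma measurable_pastD:
  assumes "U \<in> measurable (past k) N"
  shows "U \<in> measurable M N"
proof -
  have "(\<lambda>\<omega>. \<omega>) \<in> measurable M (past k)"
    unfolding past_def
    by (rule measurable_vimage_algebra2) (auto intro!: measurable_restrict measurable_sample)
  from measurable_compose[OF this assms] show ?thesis by simp
qed

text \<open>
  Conditioning a fresh sample on the past amounts to integrating it out with the query held fixed.  The
  events generated by \<open>U\<close> lie in the sigma algebra of the earlier samples, so the joint law agrees
  with the product measure on rectangles.
\<close>

lemma joint_law_past_sample:
  assumes U: "U \<in> measurable (past k) N" and k: "k \<ge> 2"
  shows "distr M (N \<Otimes>\<^sub>M P) (\<lambda>\<omega>. (U \<omega>, \<xi> k \<omega>)) = distr M N U \<Otimes>\<^sub>M P"
proof -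
  let ?W = "\<lambda>\<omega>. \<lambda>j\<in>{2..<k}. \<xi> j \<omega>" and ?V = "\<lambda>\<omega>. \<lambda>j\<in>{k}. \<xi> j \<omega>"
  let ?QV = "\<Pi>\<^sub>M j\<in>{k}. P"
  have UM: "U \<in> measurable M N" by (rule measurable_pastD[OF U])
  have \<xi>M: "\<xi> k \<in> measurable M P" by (rule measurable_sample[OF k])
  have "indep_var (\<Pi>\<^sub>M j\<in>{2..<k}. P) ?W ?QV ?V"
    using k by (intro indep_var_restrict[OF indep]) auto
  then have indep: "indep_set (sets (past k)) (sigma_sets (space M) {?V -` A \<inter> space M |A. A \<in> sets ?QV})"
    unfolding indep_var_eq past_def sets_vimage_algebra by simp
  have "distr M N U \<Otimes>\<^sub>M P = distr M (N \<Otimes>\<^sub>M P) (\<lambda>\<omega>. (U \<omega>, \<xi> k \<omega>))"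
  proof (rule pair_measure_eqI)
    interpret D: prob_space "distr M N U" by (rule prob_space_distr[OF UM])
    show "sigma_finite_measure (distr M N U)" "sigma_finite_measure P"
      by unfold_locales
    show "sets (distr M N U \<Otimes>\<^sub>M P) = sets (distr M (N \<Otimes>\<^sub>M P) (\<lambda>\<omega>. (U \<omega>, \<xi> k \<omega>)))"
      by (simp cong: sets_pair_measure_cong)
    fix A B assume "A \<in> sets (distr M N U)" and B: "B \<in> sets P"
    then have A: "A \<in> sets N" by simp
    define EA EB where "EA = U -` A \<inter> space M" and "EB = \<xi> k -` B \<inter> space M"
    have "EA \<in> sets (past k)"
      unfolding EA_def using measurable_sets[OF U A] by simp
    moreover have "EB \<in> {?V -` A \<inter> space M |A. A \<in> sets ?QV}"
    proof (intro CollectI exI conjI)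
      have "(\<lambda>x. x k) \<in> measurable ?QV P" by (rule measurable_component_singleton) simp
      then show "(\<lambda>x. x k) -` B \<inter> space ?QV \<in> sets ?QV"
        by (rule measurable_sets) (rule B)
      show "EB = ?V -` ((\<lambda>x. x k) -` B \<inter> space ?QV) \<inter> space M"
        using k by (auto simp: EB_def space_PiM sample_in_space)
    qed
    ultimately have "prob (EA \<inter> EB) = prob EA * prob EB"
      by (intro indep_setD[OF indep]) auto
    then have "emeasure M (EA \<inter> EB) = emeasure M EA * emeasure M EB"
      by (simp add: emeasure_eq_measure ennreal_mult)
    moreover have "emeasure P B = emeasure M EB"
      unfolding EB_def by (subst law[OF k, symmetric]) (rule emeasure_distr[OF \<xi>M B])
    moreover have "emeasure (distr M N U) A = emeasure M EA"
      unfolding EA_def by (rule emeasure_distr[OF UM A])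
    moreover have "emeasure (distr M (N \<Otimes>\<^sub>M P) (\<lambda>\<omega>. (U \<omega>, \<xi> k \<omega>))) (A \<times> B) = emeasure M (EA \<inter> EB)"
      using UM \<xi>M A B unfolding EA_def EB_def
      by (subst emeasure_distr) (auto intro!: arg_cong[where f = "emeasure M"])
    ultimately show "emeasure (distr M N U) A * emeasure P B
        = emeasure (distr M (N \<Otimes>\<^sub>M P) (\<lambda>\<omega>. (U \<omega>, \<xi> k \<omega>))) (A \<times> B)"
      by simp
  qed
  then show ?thesis by simp
qed

text \<open>
  Fubini's theorem for a nonnegative function of a past-measurable query and a fresh sample: a
  bound valid for each fixed query survives at a random one.
\<close>

lemma fresh_sample_moment:
  fixes h :: "'x \<Rightarrow> 's \<Rightarrow> real"
  assumes U: "U \<in> measurable (past k) N" and k: "k \<ge> 2"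
    and h: "(\<lambda>(x, s). h x s) \<in> borel_measurable (N \<Otimes>\<^sub>M P)" "\<And>x s. 0 \<le> h x s"
    and int: "\<And>x. x \<in> space N \<Longrightarrow> integrable P (h x)"
    and le: "\<And>x. x \<in> space N \<Longrightarrow> (\<integral>s. h x s \<partial>P) \<le> c"
  shows "integrable M (\<lambda>\<omega>. h (U \<omega>) (\<xi> k \<omega>))" "expectation (\<lambda>\<omega>. h (U \<omega>) (\<xi> k \<omega>)) \<le> c"
proof -
  have UM: "U \<in> measurable M N" by (rule measurable_pastD[OF U])
  have pair: "(\<lambda>\<omega>. (U \<omega>, \<xi> k \<omega>)) \<in> measurable M (N \<Otimes>\<^sub>M P)"
    using UM measurable_sample[OF k] by simp
  have meas: "(\<lambda>\<omega>. h (U \<omega>) (\<xi> k \<omega>)) \<in> borel_measurable M"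
    using measurable_compose[OF pair h(1)] by simp
  obtain \<omega>0 where "\<omega>0 \<in> space M" using not_empty by blast
  then have x0: "U \<omega>0 \<in> space N" using measurable_space[OF UM] by blast
  have "0 \<le> (\<integral>s. h (U \<omega>0) s \<partial>P)" using h(2) by (intro integral_nonneg_AE) auto
  with le[OF x0] have c: "0 \<le> c" by linarith
  interpret D: prob_space "distr M N U" by (rule prob_space_distr[OF UM])
  have "(\<integral>\<^sup>+\<omega>. ennreal (h (U \<omega>) (\<xi> k \<omega>)) \<partial>M)
      = (\<integral>\<^sup>+z. ennreal (case_prod h z) \<partial>distr M (N \<Otimes>\<^sub>M P) (\<lambda>\<omega>. (U \<omega>, \<xi> k \<omega>)))"
    using h(1) by (subst nn_integral_distr[OF pair]) auto
  also have "\<dots> = (\<integral>\<^sup>+x. \<integral>\<^sup>+s. ennreal (h x s) \<partial>P \<partial>distr M N U)"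
  proof -
    have "case_prod h \<in> borel_measurable (distr M N U \<Otimes>\<^sub>M P)"
      using h(1) unfolding measurable_cong_sets[OF sets_pair_measure_cong[OF sets_distr refl] refl] .
    then have "(\<lambda>z. ennreal (case_prod h z)) \<in> borel_measurable (distr M N U \<Otimes>\<^sub>M P)"
      by (rule measurable_compose) simp
    from P.nn_integral_fst[OF this] show ?thesis unfolding joint_law_past_sample[OF U k] by simp
  qed
  also have "\<dots> \<le> (\<integral>\<^sup>+x. ennreal c \<partial>distr M N U)"
  proof (rule nn_integral_mono)
    fix x assume "x \<in> space (distr M N U)"
    then have "x \<in> space N" by simp
    then show "(\<integral>\<^sup>+s. ennreal (h x s) \<partial>P) \<le> ennreal c"
      using int le h(2) by (subst nn_integral_eq_integral) (auto intro: ennreal_leI)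
  qed
  also have "\<dots> = ennreal c" using D.emeasure_space_1 by simp
  finally have nn: "(\<integral>\<^sup>+\<omega>. ennreal (h (U \<omega>) (\<xi> k \<omega>)) \<partial>M) \<le> ennreal c" .
  then have "(\<integral>\<^sup>+\<omega>. ennreal (h (U \<omega>) (\<xi> k \<omega>)) \<partial>M) < \<infinity>"
    by (rule le_less_trans) simp
  with meas show "integrable M (\<lambda>\<omega>. h (U \<omega>) (\<xi> k \<omega>))"
    using h(2) by (intro integrableI_nonneg) auto
  have "ennreal (expectation (\<lambda>\<omega>. h (U \<omega>) (\<xi> k \<omega>))) \<le> ennreal c"
    using nn \<open>integrable M _\<close> h(2) by (subst nn_integral_eq_integral[symmetric]) auto
  then show "expectation (\<lambda>\<omega>. h (U \<omega>) (\<xi> k \<omega>)) \<le> c"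
    using c by (simp add: ennreal_le_iff)
qed

lemma fresh_sample_unbiased:
  fixes h :: "'x \<Rightarrow> 's \<Rightarrow> real"
  assumes U: "U \<in> measurable (past k) N" and k: "k \<ge> 2"
    and h: "(\<lambda>(x, s). h x s) \<in> borel_measurable (N \<Otimes>\<^sub>M P)"
    and int: "integrable M (\<lambda>\<omega>. h (U \<omega>) (\<xi> k \<omega>))"
    and zero: "\<And>x. x \<in> space N \<Longrightarrow> (\<integral>s. h x s \<partial>P) = 0"
  shows "expectation (\<lambda>\<omega>. h (U \<omega>) (\<xi> k \<omega>)) = 0"
proof -
  have UM: "U \<in> measurable M N" by (rule measurable_pastD[OF U])
  have pair: "(\<lambda>\<omega>. (U \<omega>, \<xi> k \<omega>)) \<in> measurable M (N \<Otimes>\<^sub>M P)"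
    using UM measurable_sample[OF k] by simp
  interpret D: prob_space "distr M N U" by (rule prob_space_distr[OF UM])
  interpret DP: pair_sigma_finite "distr M N U" P ..
  have int': "integrable (distr M N U \<Otimes>\<^sub>M P) (case_prod h)"
    unfolding joint_law_past_sample[OF U k, symmetric]
    using int h by (subst integrable_distr_eq[OF pair]) auto
  have "expectation (\<lambda>\<omega>. h (U \<omega>) (\<xi> k \<omega>))
      = (\<integral>z. case_prod h z \<partial>distr M (N \<Otimes>\<^sub>M P) (\<lambda>\<omega>. (U \<omega>, \<xi> k \<omega>)))"
    using h by (subst integral_distr[OF pair]) auto
  also have "\<dots> = (\<integral>x. \<integral>s. h x s \<partial>P \<partial>distr M N U)"
    unfolding joint_law_past_sample[OF U k] using DP.integral_fst'[OF int'] by simp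
  also have "\<dots> = (\<integral>x. 0 \<partial>distr M N U)"
    using zero by (intro Bochner_Integration.integral_cong) auto
  finally show ?thesis by simp
qed

lemma gradient_query_variance:
  fixes S :: "(real^'n) set"
  assumes orc: "gradient_oracle S P gf \<sigma> g"
    and U: "U \<in> borel_measurable (past k)" "\<And>\<omega>. \<omega> \<in> space M \<Longrightarrow> U \<omega> \<in> S" and k: "k \<ge> 2"
  shows "integrable M (\<lambda>\<omega>. (norm (g (U \<omega>) (\<xi> k \<omega>) - gf (U \<omega>)))\<^sup>2)"
    "expectation (\<lambda>\<omega>. (norm (g (U \<omega>) (\<xi> k \<omega>) - gf (U \<omega>)))\<^sup>2) \<le> \<sigma>\<^sup>2"
proof -
  have g: "(\<lambda>(x, s). g x s) \<in> borel_measurable (restrict_space borel S \<Otimes>\<^sub>M P)"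
    using orc by (simp add: gradient_oracle_def)
  have [measurable]: "gf \<in> borel_measurable (restrict_space borel S)"
    by (rule borel_measurable_oracle_mean[OF P.prob_space_axioms g])
      (use orc in \<open>simp add: gradient_oracle_def\<close>)
  have U': "U \<in> measurable (past k) (restrict_space borel S)"
    using U by (intro measurable_restrict_space2) auto
  have h: "(\<lambda>(x, s). (norm (g x s - gf x))\<^sup>2) \<in> borel_measurable (restrict_space borel S \<Otimes>\<^sub>M P)"
    using g by measurable
  show "integrable M (\<lambda>\<omega>. (norm (g (U \<omega>) (\<xi> k \<omega>) - gf (U \<omega>)))\<^sup>2)"
    "expectation (\<lambda>\<omega>. (norm (g (U \<omega>) (\<xi> k \<omega>) - gf (U \<omega>)))\<^sup>2) \<le> \<sigma>\<^sup>2"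
    using orc
    by (auto intro!: fresh_sample_moment[OF U' k h] simp: gradient_oracle_def space_restrict_space)
qed

lemma hessian_query_variance:
  fixes S :: "(real^'n) set"
  assumes orc: "hessian_oracle S P Hf \<sigma> H"
    and U: "U \<in> borel_measurable (past k)" "\<And>\<omega>. \<omega> \<in> space M \<Longrightarrow> U \<omega> \<in> S" and k: "k \<ge> 2"
  shows "integrable M (\<lambda>\<omega>. (op_norm (H (U \<omega>) (\<xi> k \<omega>) - Hf (U \<omega>)))\<^sup>2)"
    "expectation (\<lambda>\<omega>. (op_norm (H (U \<omega>) (\<xi> k \<omega>) - Hf (U \<omega>)))\<^sup>2) \<le> \<sigma>\<^sup>2"
proof -
  have H: "(\<lambda>(x, s). H x s) \<in> borel_measurable (restrict_space borel S \<Otimes>\<^sub>M P)"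
    using orc by (simp add: hessian_oracle_def)
  have [measurable]: "Hf \<in> borel_measurable (restrict_space borel S)"
    by (rule borel_measurable_oracle_mean[OF P.prob_space_axioms H])
      (use orc in \<open>simp add: hessian_oracle_def\<close>)
  have U': "U \<in> measurable (past k) (restrict_space borel S)"
    using U by (intro measurable_restrict_space2) auto
  have h: "(\<lambda>(x, s). (op_norm (H x s - Hf x))\<^sup>2) \<in> borel_measurable (restrict_space borel S \<Otimes>\<^sub>M P)"
    using H by measurable
  show "integrable M (\<lambda>\<omega>. (op_norm (H (U \<omega>) (\<xi> k \<omega>) - Hf (U \<omega>)))\<^sup>2)"
    "expectation (\<lambda>\<omega>. (op_norm (H (U \<omega>) (\<xi> k \<omega>) - Hf (U \<omega>)))\<^sup>2) \<le> \<sigma>\<^sup>2"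
    using orc
    by (auto intro!: fresh_sample_moment[OF U' k h] simp: hessian_oracle_def space_restrict_space)
qed

text \<open>
  Given the past, the query \<open>U\<close> and the direction \<open>V\<close> are constants, and the noise of the fresh sample
  has mean zero.  Integrability comes from the variance bound, since \<open>V\<close> is bounded.
\<close>

lemma gradient_query_unbiased:
  fixes S :: "(real^'n) set"
  assumes orc: "gradient_oracle S P gf \<sigma> g"
    and U: "U \<in> borel_measurable (past k)" "\<And>\<omega>. \<omega> \<in> space M \<Longrightarrow> U \<omega> \<in> S" and k: "k \<ge> 2"
    and V: "V \<in> borel_measurable (past k)" "\<And>\<omega>. \<omega> \<in> space M \<Longrightarrow> norm (V \<omega>) \<le> D"
  shows "integrable M (\<lambda>\<omega>. (gf (U \<omega>) - g (U \<omega>) (\<xi> k \<omega>)) \<bullet> V \<omega>)"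
    "expectation (\<lambda>\<omega>. (gf (U \<omega>) - g (U \<omega>) (\<xi> k \<omega>)) \<bullet> V \<omega>) = 0"
proof -
  define N where "N = restrict_space (borel :: (real^'n) measure) S \<Otimes>\<^sub>M (borel :: (real^'n) measure)"
  \<comment> \<open>The query is the pair of point and direction, so the product law applies to both at once.\<close>
  define h where "h = (\<lambda>(x, v) s. (gf x - g x s) \<bullet> (v :: real^'n))"
  have g: "(\<lambda>(x, s). g x s) \<in> borel_measurable (restrict_space borel S \<Otimes>\<^sub>M P)"
    using orc by (simp add: gradient_oracle_def)
  have gf [measurable]: "gf \<in> borel_measurable (restrict_space borel S)"
    by (rule borel_measurable_oracle_mean[OF P.prob_space_axioms g])
      (use orc in \<open>simp add: gradient_oracle_def\<close>)
  have U': "U \<in> measurable (past k) (restrict_space borel S)"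
    using U by (intro measurable_restrict_space2) auto
  have UV: "(\<lambda>\<omega>. (U \<omega>, V \<omega>)) \<in> measurable (past k) N"
    unfolding N_def using U' V(1) by (rule measurable_Pair)
  have h: "(\<lambda>(x, s). h x s) \<in> borel_measurable (N \<Otimes>\<^sub>M P)"
  proof -
    have "(\<lambda>z. (fst (fst z), snd z)) \<in> measurable (N \<Otimes>\<^sub>M P) (restrict_space borel S \<Otimes>\<^sub>M P)"
      unfolding N_def by measurable
    from measurable_compose[OF this g]
    have "(\<lambda>z. g (fst (fst z)) (snd z)) \<in> borel_measurable (N \<Otimes>\<^sub>M P)" by simp
    moreover have "(\<lambda>z. gf (fst (fst z))) \<in> borel_measurable (N \<Otimes>\<^sub>M P)"
      unfolding N_def by measurable
    moreover have "(\<lambda>z. snd (fst z)) \<in> borel_measurable (N \<Otimes>\<^sub>M P)"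
      unfolding N_def by measurable
    ultimately have "(\<lambda>z. (gf (fst (fst z)) - g (fst (fst z)) (snd z)) \<bullet> snd (fst z)) \<in> borel_measurable (N \<Otimes>\<^sub>M P)"
      by measurable
    then show ?thesis by (simp add: h_def case_prod_unfold)
  qed
  have int: "integrable M (\<lambda>\<omega>. h (U \<omega>, V \<omega>) (\<xi> k \<omega>))"
  proof (rule Bochner_Integration.integrable_bound)
    show "integrable M (\<lambda>\<omega>. (1 + (norm (g (U \<omega>) (\<xi> k \<omega>) - gf (U \<omega>)))\<^sup>2) * D)"
      using gradient_query_variance(1)[OF orc U k] by simp
    show "(\<lambda>\<omega>. h (U \<omega>, V \<omega>) (\<xi> k \<omega>)) \<in> borel_measurable M"
      using measurable_compose[OF measurable_Pair[OF measurable_pastD[OF UV] measurable_sample[OF k]] h]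
      by simp
    show "AE \<omega> in M. norm (h (U \<omega>, V \<omega>) (\<xi> k \<omega>)) \<le> norm ((1 + (norm (g (U \<omega>) (\<xi> k \<omega>) - gf (U \<omega>)))\<^sup>2) * D)"
    proof (rule AE_I2)
      fix \<omega> assume \<omega>: "\<omega> \<in> space M"
      define n where "n = norm (g (U \<omega>) (\<xi> k \<omega>) - gf (U \<omega>))"
      have D: "norm (V \<omega>) \<le> D" "0 \<le> D" using V(2)[OF \<omega>] norm_ge_zero[of "V \<omega>"] by linarith+
      have "\<bar>(gf (U \<omega>) - g (U \<omega>) (\<xi> k \<omega>)) \<bullet> V \<omega>\<bar> \<le> n * norm (V \<omega>)"
        unfolding n_def by (metis Cauchy_Schwarz_ineq2 norm_minus_commute)
      also have "\<dots> \<le> (1 + n\<^sup>2) * D"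
      proof (intro mult_mono D)
        have "0 \<le> (n - 1)\<^sup>2 + n\<^sup>2 + 1" by simp
        then show "n \<le> 1 + n\<^sup>2" by (simp add: power2_eq_square algebra_simps)
      qed auto
      finally show "norm (h (U \<omega>, V \<omega>) (\<xi> k \<omega>)) \<le> norm ((1 + n\<^sup>2) * D)"
        using D by (simp add: h_def abs_mult)
    qed
  qed
  then show "integrable M (\<lambda>\<omega>. (gf (U \<omega>) - g (U \<omega>) (\<xi> k \<omega>)) \<bullet> V \<omega>)"
    by (simp add: h_def)
  have "expectation (\<lambda>\<omega>. h (U \<omega>, V \<omega>) (\<xi> k \<omega>)) = 0"
  proof (rule fresh_sample_unbiased[OF UV k h int])
    fix z assume "z \<in> space N"
    then obtain x v where z: "z = (x, v)" "x \<in> S"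
      by (auto simp: N_def space_pair_measure space_restrict_space)
    have "integrable P (\<lambda>s. gf x - g x s)" "(\<integral>s. gf x - g x s \<partial>P) = 0"
      using orc z(2) P.prob_space by (simp_all add: gradient_oracle_def)
    then show "(\<integral>s. h z s \<partial>P) = 0" by (simp add: z(1) h_def)
  qed
  then show "expectation (\<lambda>\<omega>. (gf (U \<omega>) - g (U \<omega>) (\<xi> k \<omega>)) \<bullet> V \<omega>) = 0"
    by (simp add: h_def)
qed

section \<open>The expected rate\<close>

text \<open>
  The iterates \<open>X\<close> are projections of quantities computed from earlier iterates and samples, so a
  measurable selection of the \<open>Y\<close> makes them measurable as well: \<open>X t\<close> depends on the samples with
  numbers below \<open>2 t\<close> only.
\<close>

lemma extra_newton_iterate_measurable:
  fixes X Y :: "nat \<Rightarrow> 'w \<Rightarrow> real^'n"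
  assumes S: "convex S" "closed S"
    and g: "(\<lambda>(x, s). g x s) \<in> borel_measurable (restrict_space borel S \<Otimes>\<^sub>M P)"
    and H: "(\<lambda>(x, s). H x s) \<in> borel_measurable (restrict_space borel S \<Otimes>\<^sub>M P)"
    and b: "\<And>s. s \<ge> 1 \<Longrightarrow> b s > 0" and "\<gamma> > 0" "\<beta>0 > 0" "x1 \<in> S"
    and run: "\<And>\<omega>. \<omega> \<in> space M \<Longrightarrow>
      extra_newton_run S g H a b \<gamma> \<beta>0 T x1 (\<lambda>k. \<xi> k \<omega>) (\<lambda>t. X t \<omega>) (\<lambda>t. Y t \<omega>)"
    and Y: "\<And>t. t \<in> {1..T} \<Longrightarrow> Y t \<in> borel_measurable (past (2 * t + 1))"
  shows "t \<in> {1..T + 1} \<Longrightarrow> X t \<in> borel_measurable (past (2 * t))"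
proof (induction t rule: less_induct)
  case (less t)
  show ?case
  proof (cases "t = 1")
    case True
    have "X t \<omega> = x1" if "\<omega> \<in> space M" for \<omega>
      using run[OF that] True by (simp add: extra_newton_run_def)
    then have "X t \<in> borel_measurable (past (2 * t)) \<longleftrightarrow> (\<lambda>_. x1) \<in> borel_measurable (past (2 * t))"
      by (intro measurable_cong) simp
    then show ?thesis by simp
  next
    case False
    define s where "s = t - 1"
    have t: "t = Suc s" and s: "s \<in> {1..T}" using False less.prems by (auto simp: s_def)
    define N where "N = past (2 * t)"
    have spaceN: "space N = space M" by (simp add: N_def)
    have YN: "Y r \<in> borel_measurable N" if "r \<in> {1..s}" for r
      unfolding N_def using that s t by (intro measurable_past_mono[OF _ Y[of r]]) auto
    have XN: "X r \<in> borel_measurable N" if "r \<in> {1..s}" for r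
      unfolding N_def using that s t by (intro measurable_past_mono[OF _ less.IH[of r]]) auto
    have \<xi>N: "\<xi> j \<in> measurable N P" if "2 \<le> j" "j < 2 * t" for j
      unfolding N_def using that by (rule measurable_sample_past)
    define xb where "xb r \<omega> = X_bar b (\<lambda>t. Y t \<omega>) r" for r \<omega>
    define xt where "xt r \<omega> = X_tilde b (\<lambda>t. X t \<omega>) (\<lambda>t. Y t \<omega>) r" for r \<omega>
    have XS: "X r \<omega> \<in> S" if "\<omega> \<in> space N" "r \<in> {1..T + 1}" for r \<omega>
      using extra_newton_iterates_mem(1)[OF run \<open>x1 \<in> S\<close> that(2)] that(1) by (simp add: spaceN)
    have YS: "Y r \<omega> \<in> S" if "\<omega> \<in> space N" "r \<in> {1..T}" for r \<omega>
      using extra_newton_iterates_mem(2)[OF run \<open>x1 \<in> S\<close> that(2)] that(1) by (simp add: spaceN)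
    have xbS: "xb r \<omega> \<in> S" if "r \<in> {1..s}" "\<omega> \<in> space N" for r \<omega>
      unfolding xb_def using that s
      by (intro X_bar_mem S YS b) auto
    have xtS: "xt r \<omega> \<in> S" if "r \<in> {1..s}" "\<omega> \<in> space N" for r \<omega>
      unfolding xt_def using that s
      by (intro X_tilde_mem S XS YS b) auto
    have xbN: "xb r \<in> borel_measurable N" if "r \<in> {1..s}" for r
      unfolding xb_def[abs_def] X_bar_def using that
      by (intro borel_measurable_scaleR borel_measurable_sum borel_measurable_const YN) auto
    have xtN: "xt r \<in> borel_measurable N" if "r \<in> {1..s}" for r
      unfolding xt_def[abs_def] X_tilde_def using that
      by (intro borel_measurable_scaleR borel_measurable_add borel_measurable_sum
          borel_measurable_const YN XN) auto
    have GN: "(\<lambda>\<omega>. g (xb r \<omega>) (\<xi> (2 * r + 1) \<omega>)) \<in> borel_measurable N" if "r \<in> {1..s}" for r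
      using that t by (intro borel_measurable_oracle_query[OF g] xbN xbS \<xi>N) auto
    have FN: "(\<lambda>\<omega>. F_tilde g H (xb r \<omega>) (xt r \<omega>) (\<xi> (2 * r) \<omega>)) \<in> borel_measurable N"
      if "r \<in> {1..s}" for r
      unfolding F_tilde_def using that t
      by (intro borel_measurable_add borel_measurable_matrix_vector_mult borel_measurable_diff
          borel_measurable_oracle_query[OF g] borel_measurable_oracle_query[OF H] xbN xtN xtS \<xi>N) auto
    define \<eta> where "\<eta> \<omega> = step_size g H a b \<gamma> \<beta>0 (\<lambda>k. \<xi> k \<omega>) (\<lambda>t. X t \<omega>) (\<lambda>t. Y t \<omega>) s" for \<omega>
    have \<eta>N: "\<eta> \<in> borel_measurable N"
      unfolding \<eta>_def[abs_def] step_size_def xb_def[symmetric] xt_def[symmetric]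
      by (intro borel_measurable_divide borel_measurable_const borel_measurable_sqrt[THEN measurable_compose[rotated]]
          borel_measurable_add borel_measurable_sum borel_measurable_times borel_measurable_power
          borel_measurable_norm[THEN measurable_compose[rotated]] borel_measurable_diff GN FN) auto
    have \<eta>pos: "\<eta> \<omega> > 0" for \<omega>
      unfolding \<eta>_def step_size_def using \<open>\<gamma> > 0\<close> \<open>\<beta>0 > 0\<close>
      by (simp add: add_pos_nonneg sum_nonneg)
    have X_eq: "X t \<omega> = closest_point S (X s \<omega> - \<eta> \<omega> *\<^sub>R (a s *\<^sub>R g (xb s \<omega>) (\<xi> (2 * s + 1) \<omega>)))"
      if "\<omega> \<in> space N" for \<omega>
      using run[of \<omega>] that s t
      by (intro arg_min_proximal_eq_closest_point S \<eta>pos)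
        (auto simp: extra_newton_run_def Let_def \<eta>_def xb_def spaceN)
    have "(\<lambda>\<omega>. X s \<omega> - \<eta> \<omega> *\<^sub>R (a s *\<^sub>R g (xb s \<omega>) (\<xi> (2 * s + 1) \<omega>))) \<in> borel_measurable N"
      using s by (intro borel_measurable_diff borel_measurable_scaleR borel_measurable_const XN \<eta>N GN) auto
    moreover have "closest_point S \<in> borel_measurable borel"
      using S \<open>x1 \<in> S\<close> by (intro borel_measurable_continuous_onI continuous_on_closest_point) auto
    ultimately have "(\<lambda>\<omega>. closest_point S (X s \<omega> - \<eta> \<omega> *\<^sub>R (a s *\<^sub>R g (xb s \<omega>) (\<xi> (2 * s + 1) \<omega>))))
        \<in> borel_measurable N"
      by (rule measurable_compose)
    then have "X t \<in> borel_measurable N" by (subst measurable_cong[OF X_eq])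
    then show ?thesis by (simp add: N_def)
  qed
qed

text \<open>
  Expectation of the pathwise bound.  The linear term vanishes, since sample \<open>2 t + 1\<close> is drawn
  after \<open>xb t\<close> and \<open>Y t\<close> are fixed, and each noise norm is bounded by Jensen's inequality.
\<close>

lemma extra_newton_expected_bound:
  fixes S :: "(real^'n) set" and \<phi> :: "real^'n \<Rightarrow> real" and a b :: "nat \<Rightarrow> real" and p :: real
    and X Y :: "nat \<Rightarrow> 'w \<Rightarrow> real^'n"
  assumes S: "convex S" "compact S"
    and tangent: "\<And>x y. x \<in> S \<Longrightarrow> y \<in> S \<Longrightarrow> \<phi> x + gf x \<bullet> (y - x) \<le> \<phi> y"
    and taylor: "\<And>x y. x \<in> S \<Longrightarrow> y \<in> S \<Longrightarrow>
      norm (gf y - gf x - Hf x *v (y - x)) \<le> L / 2 * (norm (y - x))\<^sup>2"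
    and xs: "xs \<in> S" "\<And>x. x \<in> S \<Longrightarrow> \<phi> xs \<le> \<phi> x"
    and orc_g: "gradient_oracle S P gf \<sigma>g g" and orc_H: "hessian_oracle S P Hf \<sigma>H H"
    and "\<sigma>g \<ge> 0" "\<sigma>H \<ge> 0" "L \<ge> 0" "p \<ge> 2"
    and a: "\<And>t. a t = real t ^ 2" and b: "\<And>t. b t = real t powr p"
    and "\<gamma> > 0" "\<beta>0 > 0" "T \<ge> 1" "x1 \<in> S"
    and run: "\<And>\<omega>. \<omega> \<in> space M \<Longrightarrow>
      extra_newton_run S g H a b \<gamma> \<beta>0 T x1 (\<lambda>k. \<xi> k \<omega>) (\<lambda>t. X t \<omega>) (\<lambda>t. Y t \<omega>)"
    and Ym: "\<And>t. t \<in> {1..T} \<Longrightarrow> Y t \<in> borel_measurable (past (2 * t + 1))"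
  defines "D \<equiv> diameter S"
  shows "expectation (\<lambda>\<omega>. \<phi> (X_bar b (\<lambda>t. Y t \<omega>) T) - \<phi> xs)
    \<le> (p + 1) / real T ^ 3 *
      ((D\<^sup>2 + \<gamma>\<^sup>2) / \<gamma> * (sqrt \<beta>0 + 2 * \<sigma>g * (real T ^ 2 * sqrt (real T))
          + (p + 1) * D * (\<sigma>H * (real T * sqrt (real T))))
        + 5 / 2 * (L / 2 * (p + 1)\<^sup>2) * D * sqrt (D\<^sup>2 + \<gamma>\<^sup>2) ^ 3 / \<gamma>)"
proof -
  define A C where "A = (D\<^sup>2 + \<gamma>\<^sup>2) / \<gamma>"
    and "C = 5 / 2 * (L / 2 * (p + 1)\<^sup>2) * D * sqrt (D\<^sup>2 + \<gamma>\<^sup>2) ^ 3 / \<gamma>"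
  define xb where "xb t \<omega> = X_bar b (\<lambda>t. Y t \<omega>) t" for t \<omega>
  define xt where "xt t \<omega> = X_tilde b (\<lambda>t. X t \<omega>) (\<lambda>t. Y t \<omega>) t" for t \<omega>
  define n1 where "n1 t \<omega> = norm (g (xb t \<omega>) (\<xi> (2 * t + 1) \<omega>) - gf (xb t \<omega>))" for t \<omega>
  define n2 where "n2 t \<omega> = norm (g (xt t \<omega>) (\<xi> (2 * t) \<omega>) - gf (xt t \<omega>))" for t \<omega>
  define nH where "nH t \<omega> = op_norm (H (xt t \<omega>) (\<xi> (2 * t) \<omega>) - Hf (xt t \<omega>))" for t \<omega>
  define Z where "Z t \<omega> = (gf (xb t \<omega>) - g (xb t \<omega>) (\<xi> (2 * t + 1) \<omega>)) \<bullet> (Y t \<omega> - xs)" for t \<omega>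
  define R where "R \<omega> = (\<Sum>t=1..T. a t * Z t \<omega>)
      + A * (sqrt \<beta>0 + L2_set (\<lambda>t. a t * (n1 t \<omega> + n2 t \<omega>)) {1..T}
          + (p + 1) * D * L2_set (\<lambda>t. real t * nH t \<omega>) {1..T}) + C" for \<omega>
  have bounded: "bounded S" and closed: "closed S" using S compact_imp_bounded compact_imp_closed by auto
  have D0: "D \<ge> 0" unfolding D_def by (rule diameter_ge_0) (rule bounded)
  have A0: "A \<ge> 0" using \<open>\<gamma> > 0\<close> by (simp add: A_def)
  have bpos: "b t > 0" if "t \<ge> 1" for t using that by (simp add: b)

  have pathwise: "real T ^ 3 / (p + 1) * (\<phi> (xb T \<omega>) - \<phi> xs) \<le> R \<omega>" if \<omega>: "\<omega> \<in> space M" for \<omega>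
  proof -
    have "transpose (H x (\<xi> k \<omega>)) = H x (\<xi> k \<omega>)" if "x \<in> S" "2 \<le> k" for x k
      using orc_H that sample_in_space[OF that(2) \<omega>] by (auto simp: hessian_oracle_def)
    from extra_newton_pathwise_bound[OF S(1) bounded tangent taylor xs this \<open>L \<ge> 0\<close> \<open>p \<ge> 2\<close> a b
        \<open>\<gamma> > 0\<close> \<open>\<beta>0 > 0\<close> \<open>T \<ge> 1\<close> \<open>x1 \<in> S\<close> run[OF \<omega>]]
    show ?thesis
      unfolding R_def Z_def n1_def n2_def nH_def xb_def xt_def A_def C_def D_def by simp
  qed

  have XS: "X r \<omega> \<in> S" if "\<omega> \<in> space M" "r \<in> {1..T + 1}" for r \<omega>
    using extra_newton_iterates_mem(1)[OF run \<open>x1 \<in> S\<close> that(2)] that(1) by simp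
  have YS: "Y r \<omega> \<in> S" if "\<omega> \<in> space M" "r \<in> {1..T}" for r \<omega>
    using extra_newton_iterates_mem(2)[OF run \<open>x1 \<in> S\<close> that(2)] that(1) by simp
  have xbS: "xb t \<omega> \<in> S" if "t \<in> {1..T}" "\<omega> \<in> space M" for t \<omega>
    unfolding xb_def using that by (intro X_bar_mem S YS bpos) auto
  have xtS: "xt t \<omega> \<in> S" if "t \<in> {1..T}" "\<omega> \<in> space M" for t \<omega>
    unfolding xt_def using that by (intro X_tilde_mem S XS YS bpos) auto
  have Xm: "X t \<in> borel_measurable (past (2 * t))" if "t \<in> {1..T + 1}" for t
    using orc_g orc_H bpos that
    by (intro extra_newton_iterate_measurable[OF S(1) closed _ _ _ \<open>\<gamma> > 0\<close> \<open>\<beta>0 > 0\<close> \<open>x1 \<in> S\<close> run Ym])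
      (auto simp: gradient_oracle_def hessian_oracle_def)
  have xbm: "xb t \<in> borel_measurable (past (2 * t + 1))" if "t \<in> {1..T}" for t
    unfolding xb_def[abs_def] X_bar_def using that
    by (intro borel_measurable_scaleR borel_measurable_sum borel_measurable_const
        measurable_past_mono[OF _ Ym]) auto
  have xtm: "xt t \<in> borel_measurable (past (2 * t))" if "t \<in> {1..T}" for t
    unfolding xt_def[abs_def] X_tilde_def using that
    by (intro borel_measurable_scaleR borel_measurable_add borel_measurable_sum
        borel_measurable_const measurable_past_mono[OF _ Ym] Xm) auto

  have n1: "integrable M (\<lambda>\<omega>. (n1 t \<omega>)\<^sup>2)" "expectation (\<lambda>\<omega>. (n1 t \<omega>)\<^sup>2) \<le> \<sigma>g\<^sup>2" if "t \<in> {1..T}" for t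
    unfolding n1_def using that by (intro gradient_query_variance[OF orc_g] xbm xbS; simp)+
  have n2: "integrable M (\<lambda>\<omega>. (n2 t \<omega>)\<^sup>2)" "expectation (\<lambda>\<omega>. (n2 t \<omega>)\<^sup>2) \<le> \<sigma>g\<^sup>2" if "t \<in> {1..T}" for t
    unfolding n2_def using that by (intro gradient_query_variance[OF orc_g] xtm xtS; simp)+
  have nH: "integrable M (\<lambda>\<omega>. (nH t \<omega>)\<^sup>2)" "expectation (\<lambda>\<omega>. (nH t \<omega>)\<^sup>2) \<le> \<sigma>H\<^sup>2" if "t \<in> {1..T}" for t
    unfolding nH_def using that by (intro hessian_query_variance[OF orc_H] xtm xtS; simp)+
  have Z: "integrable M (Z t)" "expectation (Z t) = 0" if t: "t \<in> {1..T}" for t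
  proof -
    have V: "(\<lambda>\<omega>. Y t \<omega> - xs) \<in> borel_measurable (past (2 * t + 1))"
      using Ym[OF t] by simp
    have VD: "norm (Y t \<omega> - xs) \<le> D" if "\<omega> \<in> space M" for \<omega>
      unfolding D_def using diameter_bounded_bound[OF bounded YS[OF that t] xs(1)] by (simp add: dist_norm)
    show "integrable M (Z t)" "expectation (Z t) = 0"
      unfolding Z_def[abs_def] using gradient_query_unbiased[OF orc_g xbm[OF t] xbS[OF t] _ V VD] t by auto
  qed

  have g_noise: "integrable M (\<lambda>\<omega>. (a t * (n1 t \<omega> + n2 t \<omega>))\<^sup>2)"
    "expectation (\<lambda>\<omega>. (a t * (n1 t \<omega> + n2 t \<omega>))\<^sup>2) \<le> 4 * \<sigma>g\<^sup>2 * real T ^ 4" if t: "t \<in> {1..T}" for t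
  proof -
    have le: "(n1 t \<omega> + n2 t \<omega>)\<^sup>2 \<le> 2 * (n1 t \<omega>)\<^sup>2 + 2 * (n2 t \<omega>)\<^sup>2" for \<omega>
      using sum_squares_bound[of "n1 t \<omega>" "n2 t \<omega>"] by (simp add: power2_sum)
    have n12: "integrable M (\<lambda>\<omega>. 2 * (n1 t \<omega>)\<^sup>2 + 2 * (n2 t \<omega>)\<^sup>2)" using n1[OF t] n2[OF t] by simp
    have n_nonneg: "n1 t \<omega> \<ge> 0" "n2 t \<omega> \<ge> 0" for \<omega> by (simp_all add: n1_def n2_def)
    have [measurable]: "n1 t \<in> borel_measurable M" "n2 t \<in> borel_measurable M"
    proof -
      have "(\<lambda>\<omega>. sqrt ((n1 t \<omega>)\<^sup>2)) \<in> borel_measurable M" "(\<lambda>\<omega>. sqrt ((n2 t \<omega>)\<^sup>2)) \<in> borel_measurable M"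
        using measurable_compose[OF borel_measurable_integrable[OF n1(1)[OF t]] borel_measurable_sqrt]
          measurable_compose[OF borel_measurable_integrable[OF n2(1)[OF t]] borel_measurable_sqrt]
        by simp_all
      then show "n1 t \<in> borel_measurable M" "n2 t \<in> borel_measurable M"
        using n_nonneg by simp_all
    qed
    have int: "integrable M (\<lambda>\<omega>. (n1 t \<omega> + n2 t \<omega>)\<^sup>2)"
      by (rule Bochner_Integration.integrable_bound[OF n12]) (use le in auto)
    then show "integrable M (\<lambda>\<omega>. (a t * (n1 t \<omega> + n2 t \<omega>))\<^sup>2)" by (simp add: power_mult_distrib)
    have "expectation (\<lambda>\<omega>. (n1 t \<omega> + n2 t \<omega>)\<^sup>2) \<le> expectation (\<lambda>\<omega>. 2 * (n1 t \<omega>)\<^sup>2 + 2 * (n2 t \<omega>)\<^sup>2)"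
      by (rule integral_mono[OF int n12 le])
    also have "\<dots> \<le> 4 * \<sigma>g\<^sup>2" using n1[OF t] n2[OF t] by simp
    finally have "real t ^ 4 * expectation (\<lambda>\<omega>. (n1 t \<omega> + n2 t \<omega>)\<^sup>2) \<le> real T ^ 4 * (4 * \<sigma>g\<^sup>2)"
      using t by (intro mult_mono power_mono) auto
    then show "expectation (\<lambda>\<omega>. (a t * (n1 t \<omega> + n2 t \<omega>))\<^sup>2) \<le> 4 * \<sigma>g\<^sup>2 * real T ^ 4"
      by (simp add: power_mult_distrib a mult_ac flip: power_mult)
  qed
  have H_noise: "integrable M (\<lambda>\<omega>. (real t * nH t \<omega>)\<^sup>2)"
    "expectation (\<lambda>\<omega>. (real t * nH t \<omega>)\<^sup>2) \<le> \<sigma>H\<^sup>2 * real T ^ 2" if t: "t \<in> {1..T}" for t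
  proof -
    have "(real t)\<^sup>2 * expectation (\<lambda>\<omega>. (nH t \<omega>)\<^sup>2) \<le> (real T)\<^sup>2 * \<sigma>H\<^sup>2"
      using t nH[OF t] by (intro mult_mono power_mono) auto
    then show "integrable M (\<lambda>\<omega>. (real t * nH t \<omega>)\<^sup>2)"
      "expectation (\<lambda>\<omega>. (real t * nH t \<omega>)\<^sup>2) \<le> \<sigma>H\<^sup>2 * real T ^ 2"
      using nH[OF t] by (simp_all add: power_mult_distrib mult_ac)
  qed
  have L2g: "integrable M (\<lambda>\<omega>. L2_set (\<lambda>t. a t * (n1 t \<omega> + n2 t \<omega>)) {1..T})"
    "expectation (\<lambda>\<omega>. L2_set (\<lambda>t. a t * (n1 t \<omega> + n2 t \<omega>)) {1..T})
      \<le> sqrt (\<Sum>t=1..T. 4 * \<sigma>g\<^sup>2 * real T ^ 4)"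
    by (rule expectation_L2_set_le; erule g_noise)+
  have L2H: "integrable M (\<lambda>\<omega>. L2_set (\<lambda>t. real t * nH t \<omega>) {1..T})"
    "expectation (\<lambda>\<omega>. L2_set (\<lambda>t. real t * nH t \<omega>) {1..T}) \<le> sqrt (\<Sum>t=1..T. \<sigma>H\<^sup>2 * real T ^ 2)"
    by (rule expectation_L2_set_le; erule H_noise)+
  have L2g_le: "expectation (\<lambda>\<omega>. L2_set (\<lambda>t. a t * (n1 t \<omega> + n2 t \<omega>)) {1..T})
      \<le> 2 * \<sigma>g * (real T ^ 2 * sqrt (real T))"
  proof -
    have "sqrt (\<Sum>t=1..T. 4 * \<sigma>g\<^sup>2 * real T ^ 4) = sqrt ((2 * \<sigma>g * real T ^ 2)\<^sup>2 * real T)"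
      by (simp add: power2_eq_square power4_eq_xxxx mult_ac)
    also have "\<dots> = 2 * \<sigma>g * (real T ^ 2 * sqrt (real T))"
      using \<open>\<sigma>g \<ge> 0\<close> by (simp add: real_sqrt_mult)
    finally show ?thesis using L2g(2) by (simp only:)
  qed
  have L2H_le: "expectation (\<lambda>\<omega>. L2_set (\<lambda>t. real t * nH t \<omega>) {1..T})
      \<le> \<sigma>H * (real T * sqrt (real T))"
  proof -
    have "sqrt (\<Sum>t=1..T. \<sigma>H\<^sup>2 * real T ^ 2) = sqrt ((\<sigma>H * real T)\<^sup>2 * real T)"
      by (simp add: power2_eq_square mult_ac)
    also have "\<dots> = \<sigma>H * (real T * sqrt (real T))"
      using \<open>\<sigma>H \<ge> 0\<close> by (simp add: real_sqrt_mult)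
    finally show ?thesis using L2H(2) by (simp only:)
  qed

  have Z_sum: "integrable M (\<lambda>\<omega>. \<Sum>t=1..T. a t * Z t \<omega>)"
    "expectation (\<lambda>\<omega>. \<Sum>t=1..T. a t * Z t \<omega>) = 0"
  proof -
    have Z': "integrable M (\<lambda>\<omega>. a t * Z t \<omega>)" "expectation (\<lambda>\<omega>. a t * Z t \<omega>) = 0" if "t \<in> {1..T}" for t
      using Z[OF that] by simp_all
    show "integrable M (\<lambda>\<omega>. \<Sum>t=1..T. a t * Z t \<omega>)"
      by (rule Bochner_Integration.integrable_sum[OF Z'(1)])
    show "expectation (\<lambda>\<omega>. \<Sum>t=1..T. a t * Z t \<omega>) = 0"
      by (subst Bochner_Integration.integral_sum) (use Z' in \<open>auto intro!: sum.neutral\<close>)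
  qed
  have affine: "integrable M (\<lambda>\<omega>. w0 \<omega> + A * (k0 + w1 \<omega> + k * w2 \<omega>) + C)"
    "expectation (\<lambda>\<omega>. w0 \<omega> + A * (k0 + w1 \<omega> + k * w2 \<omega>) + C)
      = expectation w0 + A * (k0 + expectation w1 + k * expectation w2) + C"
    if "integrable M w0" "integrable M w1" "integrable M w2" for w0 w1 w2 k0 k
    using that by (simp_all add: prob_space)
  have R_int: "integrable M R"
    unfolding R_def by (rule affine(1)[OF Z_sum(1) L2g(1) L2H(1)])
  have "expectation R = expectation (\<lambda>\<omega>. \<Sum>t=1..T. a t * Z t \<omega>)
      + A * (sqrt \<beta>0 + expectation (\<lambda>\<omega>. L2_set (\<lambda>t. a t * (n1 t \<omega> + n2 t \<omega>)) {1..T})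
        + (p + 1) * D * expectation (\<lambda>\<omega>. L2_set (\<lambda>t. real t * nH t \<omega>) {1..T})) + C"
    unfolding R_def by (rule affine(2)[OF Z_sum(1) L2g(1) L2H(1)])
  also have "\<dots> \<le> 0 + A * (sqrt \<beta>0 + 2 * \<sigma>g * (real T ^ 2 * sqrt (real T))
          + (p + 1) * D * (\<sigma>H * (real T * sqrt (real T)))) + C"
    using Z_sum(2) L2g_le L2H_le A0 D0 \<open>p \<ge> 2\<close>
    by (intro add_mono mult_left_mono order_refl) auto
  finally have R_le: "expectation R \<le> A * (sqrt \<beta>0 + 2 * \<sigma>g * (real T ^ 2 * sqrt (real T))
          + (p + 1) * D * (\<sigma>H * (real T * sqrt (real T)))) + C"
    by simp

  have "expectation (\<lambda>\<omega>. \<phi> (xb T \<omega>) - \<phi> xs) \<le> expectation (\<lambda>\<omega>. (p + 1) / real T ^ 3 * R \<omega>)"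
  \<comment> \<open>The upper bound is integrable, and nonnegative because it dominates the gap.\<close>
  proof (rule integral_mono')
    fix \<omega> assume \<omega>: "\<omega> \<in> space M"
    have pos: "0 < (p + 1) / real T ^ 3" using \<open>p \<ge> 2\<close> \<open>T \<ge> 1\<close> by simp
    have "(p + 1) / real T ^ 3 * (real T ^ 3 / (p + 1) * (\<phi> (xb T \<omega>) - \<phi> xs)) \<le> (p + 1) / real T ^ 3 * R \<omega>"
      using pathwise[OF \<omega>] pos by (intro mult_left_mono) auto
    then show le: "\<phi> (xb T \<omega>) - \<phi> xs \<le> (p + 1) / real T ^ 3 * R \<omega>"
      using \<open>p \<ge> 2\<close> \<open>T \<ge> 1\<close> by simp
    have "0 \<le> \<phi> (xb T \<omega>) - \<phi> xs" using xs xbS[OF _ \<omega>, of T] \<open>T \<ge> 1\<close> by simp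
    with le show "0 \<le> (p + 1) / real T ^ 3 * R \<omega>" by linarith
  qed (use R_int in simp)
  also have "\<dots> = (p + 1) / real T ^ 3 * expectation R" by simp
  also have "\<dots> \<le> (p + 1) / real T ^ 3 * (A * (sqrt \<beta>0 + 2 * \<sigma>g * (real T ^ 2 * sqrt (real T))
          + (p + 1) * D * (\<sigma>H * (real T * sqrt (real T)))) + C)"
    using R_le \<open>p \<ge> 2\<close> by (intro mult_left_mono) auto
  finally show ?thesis by (simp add: xb_def A_def C_def)
qed

end

text \<open>
  Here \<open>c = p + 1\<close>.  The constant term is brought into the stated form by
  \<open>(D\<^sup>2 + \<gamma>\<^sup>2)\<^sup>3\<^sup>/\<^sup>2 \<le> (D + \<gamma>)\<^sup>3 \<le> 4 (D\<^sup>3 + \<gamma>\<^sup>3)\<close>.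
\<close>

lemma extra_newton_rate_simplify:
  fixes c D L \<sigma>g \<sigma>H \<gamma> \<beta>0 \<tau> :: real
  assumes "c \<ge> 1" "D \<ge> 0" "L \<ge> 0" "\<sigma>g \<ge> 0" "\<sigma>H \<ge> 0" "\<gamma> > 0" "\<beta>0 \<ge> 0" "\<tau> > 0"
  shows "c / \<tau> ^ 3 *
      ((D\<^sup>2 + \<gamma>\<^sup>2) / \<gamma> * (sqrt \<beta>0 + 2 * \<sigma>g * (\<tau> ^ 2 * sqrt \<tau>) + c * D * (\<sigma>H * (\<tau> * sqrt \<tau>)))
        + 5 / 2 * (L / 2 * c\<^sup>2) * D * sqrt (D\<^sup>2 + \<gamma>\<^sup>2) ^ 3 / \<gamma>)
    \<le> 6 * c ^ 3 *
      ((D^2 + \<gamma>^2) / \<gamma> * \<sigma>g / sqrt \<tau> + (D^3 + D * \<gamma>^2) / \<gamma> * \<sigma>H / \<tau> powr (3/2)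
        + max (L * ((D^4 + D * \<gamma>^3) / \<gamma>)) (sqrt \<beta>0 * ((D^2 + \<gamma>^2) / \<gamma>)) / \<tau> ^ 3)"
proof -
  define A where "A = (D\<^sup>2 + \<gamma>\<^sup>2) / \<gamma>"
  define B where "B = L * ((D^4 + D * \<gamma>^3) / \<gamma>)"
  define m where "m = max B (sqrt \<beta>0 * A)"
  define s where "s = sqrt \<tau>"
  have s: "s > 0" "\<tau> = s\<^sup>2" using \<open>\<tau> > 0\<close> by (auto simp: s_def)
  have A0: "A \<ge> 0" using assms by (simp add: A_def)
  have B0: "B \<ge> 0" using assms by (simp add: B_def)
  have c: "c \<le> c ^ 3" "c\<^sup>2 \<le> c ^ 3"
    using power_increasing[of 1 3 c] power_increasing[of 2 3 c] \<open>c \<ge> 1\<close> by auto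
  have cube: "sqrt (D\<^sup>2 + \<gamma>\<^sup>2) ^ 3 \<le> 4 * (D ^ 3 + \<gamma> ^ 3)"
  proof -
    have "sqrt (D\<^sup>2 + \<gamma>\<^sup>2) \<le> D + \<gamma>" by (rule sqrt_sum_squares_le_sum) (use assms in auto)
    then have "sqrt (D\<^sup>2 + \<gamma>\<^sup>2) ^ 3 \<le> (D + \<gamma>) ^ 3" by (intro power_mono) auto
    also have "\<dots> \<le> 4 * (D ^ 3 + \<gamma> ^ 3)"
    proof -
      have "0 \<le> 3 * (D + \<gamma>) * (D - \<gamma>)\<^sup>2" using assms by simp
      then show ?thesis by (simp add: power2_eq_square power3_eq_cube algebra_simps)
    qed
    finally show ?thesis .
  qed
  have last: "5 / 2 * (L / 2 * c\<^sup>2) * D * sqrt (D\<^sup>2 + \<gamma>\<^sup>2) ^ 3 / \<gamma> \<le> 5 * c\<^sup>2 * m"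
  proof -
    have "5 / 2 * (L / 2 * c\<^sup>2) * D / \<gamma> * sqrt (D\<^sup>2 + \<gamma>\<^sup>2) ^ 3
        \<le> 5 / 2 * (L / 2 * c\<^sup>2) * D / \<gamma> * (4 * (D ^ 3 + \<gamma> ^ 3))"
      using assms by (intro mult_left_mono cube) auto
    also have "\<dots> = 5 * c\<^sup>2 * B"
      by (simp add: B_def algebra_simps power4_eq_xxxx power3_eq_cube add_divide_distrib)
    also have "\<dots> \<le> 5 * c\<^sup>2 * m" by (intro mult_left_mono) (auto simp: m_def)
    finally show ?thesis by simp
  qed
  have powr: "\<tau> powr (3/2) = s ^ 3"
  proof -
    have "\<tau> powr (3/2) = (s powr 2) powr (3/2)" using s by (simp add: powr_numeral)
    also have "\<dots> = s powr 3" by (simp add: powr_powr)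
    finally show ?thesis using s by (simp add: powr_numeral)
  qed
  have AD: "(D^3 + D * \<gamma>^2) / \<gamma> = D * A"
    by (simp add: A_def algebra_simps power2_eq_square power3_eq_cube)
  have "c / \<tau> ^ 3 * (A * (sqrt \<beta>0 + 2 * \<sigma>g * (\<tau> ^ 2 * s) + c * D * (\<sigma>H * (\<tau> * s)))
        + 5 / 2 * (L / 2 * c\<^sup>2) * D * sqrt (D\<^sup>2 + \<gamma>\<^sup>2) ^ 3 / \<gamma>)
      \<le> c / \<tau> ^ 3 * (m + A * (2 * \<sigma>g * (\<tau> ^ 2 * s)) + A * (c * D * (\<sigma>H * (\<tau> * s))) + 5 * c\<^sup>2 * m)"
  proof (intro mult_left_mono)
    have "A * sqrt \<beta>0 \<le> m" by (simp add: m_def mult.commute)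
    then show "A * (sqrt \<beta>0 + 2 * \<sigma>g * (\<tau> ^ 2 * s) + c * D * (\<sigma>H * (\<tau> * s)))
        + 5 / 2 * (L / 2 * c\<^sup>2) * D * sqrt (D\<^sup>2 + \<gamma>\<^sup>2) ^ 3 / \<gamma>
      \<le> m + A * (2 * \<sigma>g * (\<tau> ^ 2 * s)) + A * (c * D * (\<sigma>H * (\<tau> * s))) + 5 * c\<^sup>2 * m"
      using last by (simp only: distrib_left)
  qed (use assms in auto)
  also have "\<dots> = 2 * c * (A * \<sigma>g / s) + c\<^sup>2 * (D * A * \<sigma>H / s ^ 3) + (c + 5 * c ^ 3) * (m / \<tau> ^ 3)"
    unfolding s(2) using s(1)
    by (simp add: field_simps power2_eq_square power3_eq_cube)
  also have "\<dots> \<le> (6 * c ^ 3) * (A * \<sigma>g / s) + (6 * c ^ 3) * (D * A * \<sigma>H / s ^ 3) + (6 * c ^ 3) * (m / \<tau> ^ 3)"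
  proof -
    have nonneg: "0 \<le> A * \<sigma>g / s" "0 \<le> D * A * \<sigma>H / s ^ 3" "0 \<le> m / \<tau> ^ 3"
      using A0 B0 assms s by (auto simp: m_def le_max_iff_disj)
    have "2 * c \<le> 6 * c ^ 3" "c\<^sup>2 \<le> 6 * c ^ 3" "c + 5 * c ^ 3 \<le> 6 * c ^ 3"
      using c \<open>c \<ge> 1\<close> by linarith+
    then show ?thesis using nonneg by (intro add_mono mult_right_mono) auto
  qed
  finally show ?thesis
    unfolding AD powr A_def[symmetric] B_def[symmetric] m_def[symmetric] s_def[symmetric]
    by (simp only: distrib_left)
qed

theorem theorem3p2:
  fixes S :: "(real^'n) set"
    and f :: "real^'n \<Rightarrow> ereal"
    and gf :: "real^'n \<Rightarrow> real^'n"
    and Hf :: "real^'n \<Rightarrow> real^'n^'n"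
    and M :: "'w measure"
    and P :: "'s measure"
    and \<xi> :: "nat \<Rightarrow> 'w \<Rightarrow> 's"
    and g :: "real^'n \<Rightarrow> 's \<Rightarrow> real^'n"
    and H :: "real^'n \<Rightarrow> 's \<Rightarrow> real^'n^'n"
    and X Y :: "nat \<Rightarrow> 'w \<Rightarrow> real^'n"
    and xstar x1 :: "real^'n"
    and D L \<sigma>g \<sigma>H \<gamma> \<beta>0 p :: real
    and a b :: "nat \<Rightarrow> real"
    and T :: nat
  assumes "S \<noteq> {}" "convex S" "compact S" "D = diameter S"
    and "proper_fun f" "lower_semicontinuous f" "convex_fun f" "\<And>x. x \<in> S \<Longrightarrow> \<bar>f x\<bar> \<noteq> \<infinity>"
    and "is_gradient_on S f gf" "is_hessian_on S gf Hf"
    and "second_order_smooth S f gf Hf L"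
    and "is_arg_min f (\<lambda>x. x \<in> S) xstar"
    and "iid_samples M P \<xi>"
    and "gradient_oracle S P gf \<sigma>g g" "\<sigma>g \<ge> 0"
    and "hessian_oracle S P Hf \<sigma>H H" "\<sigma>H \<ge> 0"
    and "p \<ge> 2" "\<And>t. a t = real t ^ 2" "\<And>t. b t = real t powr p"
    and "\<gamma> > 0" "\<beta>0 > 0" "T \<ge> 1" "x1 \<in> S"
    and "\<And>\<omega>. \<omega> \<in> space M \<Longrightarrow>
           extra_newton_run S g H a b \<gamma> \<beta>0 T x1 (\<lambda>k. \<xi> k \<omega>) (\<lambda>t. X t \<omega>) (\<lambda>t. Y t \<omega>)"
    and "\<And>t. t \<in> {1..T} \<Longrightarrow> Y t \<in> borel_measurable (sample_history M P \<xi> t)"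
  shows "(\<integral>\<omega>. real_of_ereal (f (X_bar b (\<lambda>t. Y t \<omega>) T) - f xstar) \<partial>M)
           \<le> rate_const p *
              ((D^2 + \<gamma>^2) / \<gamma> * \<sigma>g / sqrt (real T)
               + (D^3 + D * \<gamma>^2) / \<gamma> * \<sigma>H / real T powr (3/2)
               + max (L * ((D^4 + D * \<gamma>^3) / \<gamma>)) (sqrt \<beta>0 * ((D^2 + \<gamma>^2) / \<gamma>)) / real T ^ 3)
         \<and> (\<gamma> = D \<longrightarrow>
            (\<integral>\<omega>. real_of_ereal (f (X_bar b (\<lambda>t. Y t \<omega>) T) - f xstar) \<partial>M)
              \<le> rate_const p *
                 (D * \<sigma>g / sqrt (real T)
                  + D^2 * \<sigma>H / real T powr (3/2)
                  + max (L * D^3) (sqrt \<beta>0 * D) / real T ^ 3))"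
proof -
  define \<phi> where "\<phi> x = real_of_ereal (f x)" for x
  define c where "c = p + 1"
  define Q where "Q = (D^2 + \<gamma>^2) / \<gamma> * \<sigma>g / sqrt (real T)
      + (D^3 + D * \<gamma>^2) / \<gamma> * \<sigma>H / real T powr (3/2)
      + max (L * ((D^4 + D * \<gamma>^3) / \<gamma>)) (sqrt \<beta>0 * ((D^2 + \<gamma>^2) / \<gamma>)) / real T ^ 3"
  define Q' where "Q' = D * \<sigma>g / sqrt (real T) + D^2 * \<sigma>H / real T powr (3/2)
      + max (L * D^3) (sqrt \<beta>0 * D) / real T ^ 3"
  define E where "E = (\<integral>\<omega>. real_of_ereal (f (X_bar b (\<lambda>t. Y t \<omega>) T) - f xstar) \<partial>M)"
  interpret iid_sampling M P \<xi>
    using assms(13) by (intro iid_sampling.intro iid_sampling_axioms.intro) (auto simp: iid_samples_def)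
  have past_eq: "past (2 * t + 1) = sample_history M P \<xi> t" for t
    by (simp add: past_def sample_history_def atLeastLessThanSuc_atLeastAtMost)
  have L: "L > 0" and lip: "\<And>x x'. x \<in> S \<Longrightarrow> x' \<in> S \<Longrightarrow> op_norm (Hf x - Hf x') \<le> L * norm (x - x')"
    using assms(11) by (auto simp: second_order_smooth_def)
  have xstar: "xstar \<in> S" using assms(12) by (simp add: is_arg_min_def)
  have min: "\<phi> xstar \<le> \<phi> x" if x: "x \<in> S" for x
  proof -
    have "f xstar \<le> f x" using assms(12) x by (auto simp: is_arg_min_linorder)
    moreover obtain r r' where "f xstar = ereal r" "f x = ereal r'"
      using assms(8)[OF x] assms(8)[OF xstar] by (metis ereal_real')
    ultimately show ?thesis by (simp add: \<phi>_def)
  qed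
  have tangent: "\<phi> x + gf x \<bullet> (y - x) \<le> \<phi> y" if "x \<in> S" "y \<in> S" for x y
    unfolding \<phi>_def by (rule convex_fun_above_tangent[OF assms(2,7,8,9) that])
  have taylor: "norm (gf y - gf x - Hf x *v (y - x)) \<le> L / 2 * (norm (y - x))\<^sup>2" if "x \<in> S" "y \<in> S" for x y
    by (rule gradient_taylor_bound[OF assms(2,10) lip that])
  have D: "D \<ge> 0" unfolding assms(4) by (rule diameter_ge_0) (rule compact_imp_bounded[OF assms(3)])
  have c: "c \<ge> 1" using assms(18) by (simp add: c_def)
  have T: "real T > 0" using assms(23) by simp
  have "E = expectation (\<lambda>\<omega>. \<phi> (X_bar b (\<lambda>t. Y t \<omega>) T) - \<phi> xstar)"
    unfolding E_def
  proof (rule Bochner_Integration.integral_cong[OF refl])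
    fix \<omega> assume "\<omega> \<in> space M"
    then have "X_bar b (\<lambda>t. Y t \<omega>) T \<in> S"
      using assms(20,23) extra_newton_iterates_mem(2)[OF assms(25) \<open>x1 \<in> S\<close>]
      by (intro X_bar_mem assms(2)) auto
    then obtain r r' where "f (X_bar b (\<lambda>t. Y t \<omega>) T) = ereal r" "f xstar = ereal r'"
      using assms(8) xstar by (metis ereal_real')
    then show "real_of_ereal (f (X_bar b (\<lambda>t. Y t \<omega>) T) - f xstar) = \<phi> (X_bar b (\<lambda>t. Y t \<omega>) T) - \<phi> xstar"
      by (simp add: \<phi>_def)
  qed
  also have "\<dots> \<le> 6 * c ^ 3 * Q"
    unfolding Q_def
  proof (rule order_trans[OF _ extra_newton_rate_simplify[OF c D less_imp_le[OF L] assms(15,17,21)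
        less_imp_le[OF assms(22)] T]])
    show "expectation (\<lambda>\<omega>. \<phi> (X_bar b (\<lambda>t. Y t \<omega>) T) - \<phi> xstar)
      \<le> c / real T ^ 3 *
        ((D\<^sup>2 + \<gamma>\<^sup>2) / \<gamma> * (sqrt \<beta>0 + 2 * \<sigma>g * (real T ^ 2 * sqrt (real T))
            + c * D * (\<sigma>H * (real T * sqrt (real T))))
          + 5 / 2 * (L / 2 * c\<^sup>2) * D * sqrt (D\<^sup>2 + \<gamma>\<^sup>2) ^ 3 / \<gamma>)"
      unfolding c_def assms(4)
    proof (rule extra_newton_expected_bound[OF assms(2,3) tangent taylor xstar min assms(14,16,15,17)
          less_imp_le[OF L] assms(18-25)])
      show "Y t \<in> borel_measurable (past (2 * t + 1))" if "t \<in> {1..T}" for t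
        unfolding past_eq by (rule assms(26)[OF that])
    qed
  qed
  finally have E_le: "E \<le> 6 * c ^ 3 * Q" .
  have Q: "Q \<ge> 0" and Q': "Q' \<ge> 0"
    unfolding Q_def Q'_def using D L assms(15,17,21,22)
    by (auto intro!: add_nonneg_nonneg divide_nonneg_nonneg simp: le_max_iff_disj)
  have rate: "rate_const p = 100 * c ^ 3" by (simp add: rate_const_def c_def)
  have "6 * c ^ 3 * Q \<le> rate_const p * Q"
    unfolding rate using Q c by (intro mult_right_mono) auto
  with E_le have general: "E \<le> rate_const p * Q" by linarith
  \<comment> \<open>For \<open>\<gamma> = D\<close> every term doubles; the constant leaves room for this factor.\<close>
  have special: "E \<le> rate_const p * Q'" if "\<gamma> = D"
  proof -
    have D0: "D > 0" using that assms(21) by simp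
    have quot: "(D^2 + D^2) / D = 2 * D" "(D^3 + D * D^2) / D = 2 * D^2" "(D^4 + D * D^3) / D = 2 * D^3"
      using D0 by (simp_all add: field_simps power2_eq_square power3_eq_cube power4_eq_xxxx)
    have "max (L * (2 * D^3)) (sqrt \<beta>0 * (2 * D)) = 2 * max (L * D^3) (sqrt \<beta>0 * D)"
      by (simp add: max_def)
    then have "Q = 2 * Q'"
      unfolding Q_def Q'_def that quot by (simp add: algebra_simps)
    then have "6 * c ^ 3 * Q = 12 * c ^ 3 * Q'" by simp
    also have "\<dots> \<le> rate_const p * Q'"
      unfolding rate using Q' c by (intro mult_right_mono) auto
    finally show ?thesis using E_le by linarith
  qed
  show ?thesis
    using general special unfolding E_def Q_def Q'_def by blast
qed

end
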